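(* Let $f:[0,\infty)\to[0,\infty)$ be a locally integrable function with $\lambda_t f\to\infty$ as $t\to\infty$. (0) If $f$ satisfies orderly divergence, i.e. $R_t=\dfrac{S_t f}{\lambda_t f}\to 1$ in probability as $t\to\infty$, then $\ell_t=\dfrac{\lambda_{t-1}f}{\lambda_t f}\to 1$ as $t\to\infty$. (1) If $f$ is locally square integrable and $f(t)\to\infty$ as $t\to\infty$, then $b_t\to 0$ implies $v_t\to 0$, where $b_t=\dfrac{f(t)}{\lambda_t f}$ and $v_t=\dfrac{\lambda_t (f^2)}{(\lambda_t f)^2}$. (2) If $f$ is monotonic, then $\ell_t\to 1$ if and only if $b_t\to 0$.
   Context: $(S_t)_{t\ge 0}$ is the standard Gamma process: the increasing Lévy process with $S_0=0$ and $\mathbb{E}e^{-\theta S_t}=(1+\theta)^{-t}$ for $\theta\ge 0$ (so $S_1$ is exponential with mean 1). For a measurable locally integrable $f\ge 0$ put $\lambda_t f=\int_0^t f(x)\,dx$ and $S_t f=\int_0^t f\,dS$ (pathwise integral over $(0,t]$; it is a.s. finite, $\mathbb{E}\,S_tf=\lambda_t f$, and $-\ln \mathbb{E}e^{-\theta S_t f}=\int_0^t\ln(1+\theta f(x))\,dx$ for $\theta\ge0$). All limits are as $t\to\infty$; the quotients are considered for $t$ large enough that the denominators are positive. "Monotonic" means increasing or decreasing, not necessarily strictly. *)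

theory Defs
  imports "HOL-Probability.Probability"
begin

text \<open>
  Processes are indexed by \<open>real\<close>; only indices \<open>t \<ge> 0\<close> are constrained. Path properties are
  required almost surely. Stochastic continuity, which some authors list as a separate axiom,
  follows from right-continuity of paths together with stationarity of increments.
\<close>

locale levy_process = prob_space M
  for M :: "'a measure" and S :: "real \<Rightarrow> 'a \<Rightarrow> real" +
  assumes random_variable_S: "\<And>t. 0 \<le> t \<Longrightarrow> random_variable borel (S t)"
    and S_zero: "AE \<omega> in M. S 0 \<omega> = 0"
    and indep_increments:
      "\<And>(n::nat) (ts::nat \<Rightarrow> real). 0 \<le> ts 0 \<Longrightarrow> mono_on {..n} ts \<Longrightarrow>
         indep_vars (\<lambda>_. borel) (\<lambda>i \<omega>. S (ts (Suc i)) \<omega> - S (ts i) \<omega>) {..<n}"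
    and stationary_increments:
      "\<And>s h. 0 \<le> s \<Longrightarrow> 0 \<le> h \<Longrightarrow>
         distr M borel (\<lambda>\<omega>. S (s + h) \<omega> - S s \<omega>) = distr M borel (\<lambda>\<omega>. S h \<omega> - S 0 \<omega>)"
    and right_continuous_paths:
      "AE \<omega> in M. \<forall>t\<ge>0. continuous (at_right t) (\<lambda>s. S s \<omega>)"
    and left_limits_paths:
      "AE \<omega> in M. \<forall>t>0. \<exists>l. ((\<lambda>s. S s \<omega>) \<longlongrightarrow> l) (at_left t)"

locale gamma_process = levy_process M S
  for M :: "'a measure" and S :: "real \<Rightarrow> 'a \<Rightarrow> real" +
  assumes increasing_paths: "AE \<omega> in M. mono_on {0..} (\<lambda>t. S t \<omega>)"
    and laplace_transform:
      "\<And>t \<theta>. 0 \<le> t \<Longrightarrow> 0 \<le> \<theta> \<Longrightarrow>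
         expectation (\<lambda>\<omega>. exp (- \<theta> * S t \<omega>)) = (1 + \<theta>) powr (- t)"

text \<open>
  Functions on the half line are total functions on \<open>real\<close> of which only the values on \<open>{0..}\<close>
  matter. Measurability is Lebesgue measurability (implied by \<open>absolutely_integrable_on\<close>).
\<close>

definition locally_integrable :: "(real \<Rightarrow> real) \<Rightarrow> bool" where
  "locally_integrable f \<longleftrightarrow> (\<forall>t\<ge>0. f absolutely_integrable_on {0..t})"

definition lam :: "real \<Rightarrow> (real \<Rightarrow> real) \<Rightarrow> real" where
  "lam t f = (LINT x:{0..t}|lebesgue. f x)"

text \<open>
  The Lebesgue--Stieltjes measure of a path, which is constantly continued to the left of \<open>0\<close> and
  so charges only \<open>{0<..}\<close>. It is completed so that the pathwise integral also makes sense for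
  integrands that are Lebesgue but not Borel measurable: a Lebesgue null set is almost surely null
  for the path measure. For Borel integrands completion does not change the integral.
\<close>

definition path_measure :: "(real \<Rightarrow> 'a \<Rightarrow> real) \<Rightarrow> 'a \<Rightarrow> real measure" where
  "path_measure S \<omega> = completion (interval_measure (\<lambda>x. S (max 0 x) \<omega>))"

definition path_integral :: "(real \<Rightarrow> 'a \<Rightarrow> real) \<Rightarrow> real \<Rightarrow> (real \<Rightarrow> real) \<Rightarrow> 'a \<Rightarrow> real" where
  "path_integral S t f \<omega> = (LINT x:{0<..t}|path_measure S \<omega>. f x)"

text \<open>
  As paths are only controlled almost surely, \<open>\<lambda>\<omega>. path_integral S t f \<omega>\<close> need be measurable only
  with respect to the completion of \<open>M\<close>, which is therefore used to measure the events below.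
\<close>

definition converges_in_probability ::
  "'a measure \<Rightarrow> (real \<Rightarrow> 'a \<Rightarrow> real) \<Rightarrow> real \<Rightarrow> bool" where
  "converges_in_probability M X c \<longleftrightarrow>
     (\<forall>\<epsilon>>0. ((\<lambda>t. measure (completion M) {\<omega> \<in> space M. \<bar>X t \<omega> - c\<bar> > \<epsilon>}) \<longlongrightarrow> 0) at_top)"

definition orderly_divergence ::
  "'a measure \<Rightarrow> (real \<Rightarrow> 'a \<Rightarrow> real) \<Rightarrow> (real \<Rightarrow> real) \<Rightarrow> bool" where
  "orderly_divergence M S f \<longleftrightarrow>
     converges_in_probability M (\<lambda>t \<omega>. path_integral S t f \<omega> / lam t f) 1"

definition ell_quot :: "(real \<Rightarrow> real) \<Rightarrow> real \<Rightarrow> real" where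
  "ell_quot f t = lam (t - 1) f / lam t f"

definition b_quot :: "(real \<Rightarrow> real) \<Rightarrow> real \<Rightarrow> real" where
  "b_quot f t = f t / lam t f"

definition v_quot :: "(real \<Rightarrow> real) \<Rightarrow> real \<Rightarrow> real" where
  "v_quot f t = lam t (\<lambda>x. (f x)\<^sup>2) / (lam t f)\<^sup>2"

end

theory Submission
  imports Defs
begin

text \<open>
  Part (0) rests on the Laplace functional of the path integral. Along partitions it is a product of
  Laplace transforms of independent increments, which settles continuous integrands; every Lebesgue
  measurable integrand is an almost everywhere limit of continuous ones, and null sets are almost
  surely not charged by the path measure because its mean is Lebesgue measure. Orderly divergence
  therefore forces \<open>\<integral> ln (1 + f / \<lambda>\<^sub>t f) \<rightarrow> 1\<close> over \<open>[0, t]\<close>. With \<open>d = 1 - \<ell>\<^sub>t\<close>, Jensen's inequality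
  on the last unit interval bounds this integral by \<open>1 - d + ln (1 + d)\<close>, and so \<open>d \<rightarrow> 0\<close>.

  For part (1), eventually \<open>f x \<le> \<epsilon> \<lambda>\<^sub>x f \<le> \<epsilon> \<lambda>\<^sub>t f\<close> for \<open>x \<le> t\<close>, whence \<open>\<lambda>\<^sub>t (f\<^sup>2) \<le> C + \<epsilon> (\<lambda>\<^sub>t f)\<^sup>2\<close>.
  For part (2), a monotonic \<open>f\<close> is compared with its integral over an adjacent unit interval.
\<close>

subsection \<open>Riemann sums and completion\<close>

text \<open>Multiplying by \<open>n / t\<close> turns the cells of the uniform grid into the
  intervals between consecutive integers, open on the left and closed on the right. Hence the
  ceiling of \<open>x * n / t\<close>, lowered by one because cells are counted from
  \<open>0\<close>, names the only cell that contains \<open>x\<close>.\<close>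

lemma Ioc_cell_index:
  fixes t x :: real
  assumes "0 < n" "0 < x" "x \<le> t"
  obtains j where "j < n"
    "\<And>i. i < n \<Longrightarrow> x \<in> {t * real i / real n<..t * real (Suc i) / real n} \<longleftrightarrow> i = j"
proof -
  define k where "k = \<lceil>x * real n / t\<rceil>"
  have t: "0 < t" using assms by simp
  have k: "real_of_int k - 1 < x * real n / t" "x * real n / t \<le> real_of_int k"
    unfolding k_def by linarith+
  have "0 < x * real n / t" using assms t by simp
  then have k0: "0 < k" using k by linarith
  have "x * real n / t \<le> real n" using assms t by (simp add: field_simps)
  then have kn: "k \<le> int n" unfolding k_def by (simp add: ceiling_le_iff)
  define j where "j = nat (k - 1)"
  have j: "real_of_int k = real (Suc j)" using k0 by (simp add: j_def)
  show ?thesis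
  proof
    show "j < n" using kn k0 by (simp add: j_def)
    fix i assume "i < n"
    have "x \<in> {t * real i / real n<..t * real (Suc i) / real n} \<longleftrightarrow>
        real i < x * real n / t \<and> x * real n / t \<le> real (Suc i)"
      using assms t by (simp add: field_simps)
    also have "\<dots> \<longleftrightarrow> i = j"
      using k unfolding j by auto
    finally show "x \<in> {t * real i / real n<..t * real (Suc i) / real n} \<longleftrightarrow> i = j" .
  qed
qed

text \<open>The sum is the integral of the step function \<open>s n\<close>, which takes on each
  cell the value of \<open>g\<close> at the right endpoint. Continuity of \<open>g\<close> gives
  pointwise convergence, compactness of \<open>{0..t}\<close> a uniform bound, and finiteness of
  \<open>N\<close> on \<open>{0<..t}\<close> makes that bound an integrable majorant. Leaving
  \<open>N\<close> general serves both path measures and Lebesgue measure.\<close>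

lemma Riemann_sums_tendsto_integral:
  fixes g :: "real \<Rightarrow> real"
  assumes sets [measurable_cong]: "sets N = sets borel"
    and fin: "emeasure N {0<..t} < \<infinity>"
    and t: "0 < t" and g: "continuous_on UNIV g"
  shows "(\<lambda>n. \<Sum>i<n. g (t * real (Suc i) / real n) *
            measure N {t * real i / real n<..t * real (Suc i) / real n})
         \<longlonglongrightarrow> (LINT x:{0<..t}|N. g x)"
proof -
  let ?I = "\<lambda>n i. {t * real i / real n<..t * real (Suc i) / real n}"
  define s where "s n x = (\<Sum>i<n. indicator (?I n i) x * g (t * real (Suc i) / real n))" for n x
  have gm [measurable]: "g \<in> borel_measurable borel"
    using g by (simp add: borel_measurable_continuous_onI)
  have "compact (g ` {0..t})"
    by (intro compact_continuous_image continuous_on_subset[OF g]) auto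
  then obtain B where B: "\<And>x. x \<in> {0..t} \<Longrightarrow> \<bar>g x\<bar> \<le> B"
    using compact_imp_bounded bounded_iff by (metis image_eqI real_norm_def)
  have s_cell: "\<exists>j<n. s n x = g (t * real (Suc j) / real n) \<and> x \<in> ?I n j"
    if n: "0 < n" and x: "0 < x" "x \<le> t" for n x
  proof -
    obtain j where j: "j < n" "\<And>i. i < n \<Longrightarrow> x \<in> ?I n i \<longleftrightarrow> i = j"
      using Ioc_cell_index[OF n x] by metis
    have "s n x = (\<Sum>i<n. if i = j then g (t * real (Suc i) / real n) else 0)"
      unfolding s_def using j(2) by (intro sum.cong) (auto simp: indicator_def)
    then show ?thesis using j by auto
  qed
  have grid: "t * real (Suc j) / real n \<in> {0..t}" if "j < n" for n j
  proof -
    have "t * real (Suc j) \<le> t * real n" using t that by (intro mult_left_mono) auto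
    then show ?thesis using t that by (simp add: pos_divide_le_eq)
  qed
  have sub: "?I n i \<subseteq> {0<..t}" if "i < n" for n i
  proof
    fix x assume x: "x \<in> ?I n i"
    have "0 \<le> t * real i / real n" using t by simp
    moreover have "t * real (Suc i) / real n \<le> t" using grid[OF that] by simp
    ultimately show "x \<in> {0<..t}" using x by auto
  qed
  have s_out: "s n x = 0" if "x \<notin> {0<..t}" for n x
  proof -
    have "x \<notin> ?I n i" if "i < n" for i using sub[OF that] \<open>x \<notin> {0<..t}\<close> by blast
    then show ?thesis by (simp add: s_def)
  qed
  have "0 \<le> B" using B[of t] t by force
  have "(\<lambda>n. integral\<^sup>L N (s n)) \<longlonglongrightarrow> integral\<^sup>L N (\<lambda>x. indicator {0<..t} x * g x)"
  proof (rule integral_dominated_convergence[where w = "\<lambda>x. B * indicator {0<..t} x"])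
    show "integrable N (\<lambda>x. B * indicator {0<..t} x)"
      using fin by (simp add: integrable_real_indicator sets)
    show "AE x in N. (\<lambda>n. s n x) \<longlonglongrightarrow> indicator {0<..t} x * g x"
    proof (rule AE_I2)
      fix x show "(\<lambda>n. s n x) \<longlonglongrightarrow> indicator {0<..t} x * g x"
      proof (cases "x \<in> {0<..t}")
        case True
        \<comment> \<open>There are no cells for \<open>n = 0\<close>, so the chosen index is
          constrained for positive \<open>n\<close> only.\<close>
        then have "\<forall>n. \<exists>j. 0 < n \<longrightarrow> s n x = g (t * real (Suc j) / real n) \<and> x \<in> ?I n j"
          using s_cell[of _ x] by (meson greaterThanAtMost_iff)
        then obtain j where j: "\<And>n. 0 < n \<Longrightarrow> s n x = g (t * real (Suc (j n)) / real n)"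
            "\<And>n. 0 < n \<Longrightarrow> t * real (j n) / real n < x"
            "\<And>n. 0 < n \<Longrightarrow> x \<le> t * real (Suc (j n)) / real n"
          unfolding choice_iff greaterThanAtMost_iff by blast
        have step: "t * real (Suc (j n)) / real n = t * real (j n) / real n + t / real n" for n
          by (simp add: add_divide_distrib distrib_left)
        have lim: "(\<lambda>n. t * real (Suc (j n)) / real n) \<longlonglongrightarrow> x"
        proof (rule real_tendsto_sandwich[of "\<lambda>_. x" _ _ "\<lambda>n. x + t / real n"])
          show "\<forall>\<^sub>F n in sequentially. x \<le> t * real (Suc (j n)) / real n"
            using eventually_gt_at_top[of 0] by (rule eventually_mono) (rule j(3))
          show "\<forall>\<^sub>F n in sequentially. t * real (Suc (j n)) / real n \<le> x + t / real n"
            using eventually_gt_at_top[of 0] unfolding step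
            by (rule eventually_mono) (simp add: j(2) less_imp_le)
          show "(\<lambda>n. x + t / real n) \<longlonglongrightarrow> x" by real_asymp
        qed simp
        have "isCont g x" using g by (simp add: continuous_on_eq_continuous_at)
        from isCont_tendsto_compose[OF this lim]
        have "(\<lambda>n. g (t * real (Suc (j n)) / real n)) \<longlonglongrightarrow> g x" .
        moreover have "\<forall>\<^sub>F n in sequentially. g (t * real (Suc (j n)) / real n) = s n x"
          using eventually_gt_at_top[of 0] by (rule eventually_mono) (simp only: j(1))
        ultimately show ?thesis using True by (simp add: tendsto_cong)
      qed (simp add: s_out)
    qed
    show "AE x in N. norm (s n x) \<le> B * indicator {0<..t} x" for n
    proof (rule AE_I2)
      fix x
      show "norm (s n x) \<le> B * indicator {0<..t} x"
      proof (cases "n = 0")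
        case True then show ?thesis using \<open>0 \<le> B\<close> by (simp add: s_def indicator_def)
      next
        case False
        show ?thesis
        proof (cases "x \<in> {0<..t}")
          case True
          then show ?thesis using s_cell[of n x] False B[OF grid] by auto
        qed (simp add: s_out)
      qed
    qed
  qed (unfold s_def, measurable)
  moreover have "integral\<^sup>L N (s n) = (\<Sum>i<n. g (t * real (Suc i) / real n) * measure N (?I n i))" for n
  proof -
    have "integrable N (indicator (?I n i) :: real \<Rightarrow> real)" if "i < n" for i
      using le_less_trans[OF emeasure_mono[OF sub[OF that]] fin]
      by (simp add: integrable_real_indicator sets)
    then have "integral\<^sup>L N (s n) = (\<Sum>i<n. \<integral>x. indicator (?I n i) x * g (t * real (Suc i) / real n) \<partial>N)"
      unfolding s_def by (intro Bochner_Integration.integral_sum) auto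
    also have "\<dots> = (\<Sum>i<n. g (t * real (Suc i) / real n) * measure N (?I n i))"
      by (intro sum.cong) (auto simp: sets_eq_imp_space_eq[OF sets])
    finally show ?thesis .
  qed
  ultimately show ?thesis by (simp add: set_lebesgue_integral_def)
qed

text \<open>The preimages of a Borel set under \<open>f\<close> and \<open>g\<close> agree up to a
  null set, and the completion contains every set that agrees almost everywhere with a measurable
  one.\<close>

lemma borel_measurable_completion_AE:
  assumes g: "g \<in> borel_measurable M" and ae: "AE x in M. f x = g x"
  shows "f \<in> borel_measurable (completion M)"
proof (rule measurableI)
  fix A :: "'b set" assume A: "A \<in> sets borel"
  show "f -` A \<inter> space (completion M) \<in> sets (completion M)"
  proof (rule completion.in_sets_AE)
    show "AE x in completion M. x \<in> g -` A \<inter> space M \<longleftrightarrow> x \<in> f -` A \<inter> space (completion M)"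
      using AE_completion[OF ae] by eventually_elim auto
    show "g -` A \<inter> space M \<in> sets (completion M)"
      using g A by (intro sets_completionI_sets) (rule measurable_sets)
  qed simp
qed simp

subsection \<open>The path measure as a random measure\<close>

text \<open>The path properties hold only almost surely. Collecting them on one measurable event
  \<open>G\<close> of full probability allows pathwise arguments;
  \<open>path_integral_laplace\<close> supplies such an event for every Gamma process.\<close>

locale regular_gamma_process = gamma_process M S
  for M :: "'a measure" and S :: "real \<Rightarrow> 'a \<Rightarrow> real" +
  fixes G :: "'a set"
  assumes G_sets [measurable]: "G \<in> sets M"
    and AE_G: "AE \<omega> in M. \<omega> \<in> G"
    and zero_on_G: "\<And>\<omega>. \<omega> \<in> G \<Longrightarrow> S 0 \<omega> = 0"
    and mono_on_G: "\<And>\<omega>. \<omega> \<in> G \<Longrightarrow> mono_on {0..} (\<lambda>t. S t \<omega>)"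
    and right_continuous_on_G:
      "\<And>\<omega> t. \<omega> \<in> G \<Longrightarrow> 0 \<le> t \<Longrightarrow> continuous (at_right t) (\<lambda>s. S s \<omega>)"
begin

text \<open>Cutting the paths off outside the good event \<open>G\<close> makes \<open>\<kappa> \<omega>\<close> a Lebesgue--Stieltjes measure
  for every \<open>\<omega>\<close>, so that \<open>\<kappa>\<close> is a kernel on all of \<open>M\<close>.\<close>

definition X :: "real \<Rightarrow> 'a \<Rightarrow> real" where
  "X t \<omega> = indicator G \<omega> * S (max 0 t) \<omega>"

definition \<kappa> :: "'a \<Rightarrow> real measure" where
  "\<kappa> \<omega> = interval_measure (\<lambda>t. X t \<omega>)"

lemma X_measurable [measurable]: "X t \<in> borel_measurable M"
proof -
  have [measurable]: "S (max 0 t) \<in> borel_measurable M"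
    by (rule random_variable_S) simp
  show ?thesis unfolding X_def by measurable
qed

lemma AE_X_eq_S:
  assumes "0 \<le> t"
  shows "AE \<omega> in M. X t \<omega> = S t \<omega>"
  using AE_G assms by (auto simp: X_def elim!: eventually_mono)

lemma X_mono: "s \<le> t \<Longrightarrow> X s \<omega> \<le> X t \<omega>"
  using mono_on_G[of \<omega>] by (auto simp: X_def indicator_def mono_on_def)

lemma X_right_continuous: "continuous (at_right a) (\<lambda>t. X t \<omega>)"
proof (cases "\<omega> \<in> G")
  case G: True
  have "continuous (at_right a) (\<lambda>t. S (max 0 t) \<omega>)"
  proof (cases "0 \<le> a")
    case True
    have "((\<lambda>s. S s \<omega>) \<longlongrightarrow> S a \<omega>) (at_right a)"
      using right_continuous_on_G[OF G True] by (simp add: continuous_within)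
    moreover have "\<forall>\<^sub>F s in at_right a. S s \<omega> = S (max 0 s) \<omega>"
      using True by (auto simp: eventually_at_filter intro!: always_eventually)
    ultimately show ?thesis using True by (simp add: continuous_within tendsto_cong)
  next
    case False
    have "\<forall>\<^sub>F s in at_right a. S (max 0 s) \<omega> = S 0 \<omega>"
      using eventually_at_right_real[of a 0] False by (auto elim!: eventually_mono)
    then show ?thesis using False
      by (simp add: continuous_within tendsto_eventually)
  qed
  then show ?thesis using G by (simp add: X_def)
qed (simp add: X_def)

lemma sets_\<kappa> [simp, measurable_cong]: "sets (\<kappa> \<omega>) = sets borel"
  by (simp add: \<kappa>_def)

lemma space_\<kappa> [simp]: "space (\<kappa> \<omega>) = UNIV"
  by (simp add: \<kappa>_def)

lemma emeasure_\<kappa>_Ioc: "a \<le> b \<Longrightarrow> emeasure (\<kappa> \<omega>) {a<..b} = ennreal (X b \<omega> - X a \<omega>)"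
  unfolding \<kappa>_def by (rule emeasure_interval_measure_Ioc[OF _ X_mono X_right_continuous])

lemma measure_\<kappa>_Ioc: "a \<le> b \<Longrightarrow> measure (\<kappa> \<omega>) {a<..b} = X b \<omega> - X a \<omega>"
  using X_mono[of a b \<omega>] by (simp add: measure_def emeasure_\<kappa>_Ioc)

lemma path_measure_eq_completion_\<kappa>: "\<omega> \<in> G \<Longrightarrow> path_measure S \<omega> = completion (\<kappa> \<omega>)"
  by (simp add: path_measure_def \<kappa>_def X_def)

section \<open>Increments of the process and the mean of the path measure\<close>

lemma expectation_exp_increment:
  assumes "0 \<le> a" "a \<le> b" "0 \<le> \<theta>"
  shows "expectation (\<lambda>\<omega>. exp (- \<theta> * (S b \<omega> - S a \<omega>))) = (1 + \<theta>) powr (- (b - a))"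
proof -
  have [measurable]: "S a \<in> borel_measurable M" "S b \<in> borel_measurable M"
    "S 0 \<in> borel_measurable M" "S (b - a) \<in> borel_measurable M"
    using assms by (auto intro: random_variable_S)
  have "expectation (\<lambda>\<omega>. exp (- \<theta> * (S b \<omega> - S a \<omega>))) =
      (\<integral>x. exp (- \<theta> * x) \<partial>distr M borel (\<lambda>\<omega>. S b \<omega> - S a \<omega>))"
    by (subst integral_distr) auto
  also have "distr M borel (\<lambda>\<omega>. S b \<omega> - S a \<omega>) = distr M borel (\<lambda>\<omega>. S (b - a) \<omega> - S 0 \<omega>)"
    using stationary_increments[of a "b - a"] assms by simp
  also have "(\<integral>x. exp (- \<theta> * x) \<partial>\<dots>) = expectation (\<lambda>\<omega>. exp (- \<theta> * (S (b - a) \<omega> - S 0 \<omega>)))"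
    by (subst integral_distr) auto
  also have "\<dots> = expectation (\<lambda>\<omega>. exp (- \<theta> * S (b - a) \<omega>))"
    using S_zero by (intro integral_cong_AE) auto
  also have "\<dots> = (1 + \<theta>) powr (- (b - a))"
    using assms by (intro laplace_transform) auto
  finally show ?thesis .
qed

text \<open>Independence splits the expectation of the product of exponentials, and each factor is
  then known from its increment alone. Increments are almost surely nonnegative, so every factor is
  bounded by \<open>1\<close> and integrable.\<close>

lemma expectation_exp_sum_increments:
  fixes ts c :: "nat \<Rightarrow> real"
  assumes ts: "0 \<le> ts 0" "mono ts" and c: "\<And>i. 0 \<le> c i"
  shows "expectation (\<lambda>\<omega>. exp (- (\<Sum>i<n. c i * (X (ts (Suc i)) \<omega> - X (ts i) \<omega>)))) =
    (\<Prod>i<n. (1 + c i) powr (- (ts (Suc i) - ts i)))"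
proof -
  have ts0: "0 \<le> ts i" for i using ts monoD[OF ts(2), of 0 i] by simp
  have [measurable]: "S (ts i) \<in> borel_measurable M" for i
    using ts0 by (rule random_variable_S)
  have "AE \<omega> in M. \<forall>i. X (ts i) \<omega> = S (ts i) \<omega>"
    using AE_X_eq_S[OF ts0] by (simp add: AE_all_countable)
  then have "expectation (\<lambda>\<omega>. exp (- (\<Sum>i<n. c i * (X (ts (Suc i)) \<omega> - X (ts i) \<omega>)))) =
      expectation (\<lambda>\<omega>. \<Prod>i<n. exp (- c i * (S (ts (Suc i)) \<omega> - S (ts i) \<omega>)))"
    by (intro integral_cong_AE) (auto simp: exp_sum[symmetric] sum_negf)
  also have "\<dots> = (\<Prod>i<n. expectation (\<lambda>\<omega>. exp (- c i * (S (ts (Suc i)) \<omega> - S (ts i) \<omega>))))"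
  proof (rule indep_vars_lebesgue_integral)
    have "indep_vars (\<lambda>_. borel) (\<lambda>i \<omega>. S (ts (Suc i)) \<omega> - S (ts i) \<omega>) {..<n}"
      using ts by (intro indep_increments) (auto simp: mono_on_def mono_def)
    from indep_vars_compose2[OF this, of "\<lambda>i x. exp (- c i * x)" "\<lambda>_. borel"]
    show "indep_vars (\<lambda>_. borel) (\<lambda>i \<omega>. exp (- c i * (S (ts (Suc i)) \<omega> - S (ts i) \<omega>))) {..<n}"
      by simp
    fix i
    have "AE \<omega> in M. 0 \<le> S (ts (Suc i)) \<omega> - S (ts i) \<omega>"
      using AE_X_eq_S[OF ts0[of i]] AE_X_eq_S[OF ts0[of "Suc i"]]
    proof eventually_elim
      case (elim \<omega>)
      then show ?case using X_mono[of "ts i" "ts (Suc i)" \<omega>] monoD[OF ts(2), of i "Suc i"] by simp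
    qed
    then show "integrable M (\<lambda>\<omega>. exp (- c i * (S (ts (Suc i)) \<omega> - S (ts i) \<omega>)))"
      using c by (intro integrable_const_bound[where B = 1]) auto
  qed simp
  also have "\<dots> = (\<Prod>i<n. (1 + c i) powr (- (ts (Suc i) - ts i)))"
    using ts0 c monoD[OF ts(2)] by (intro prod.cong expectation_exp_increment) auto
  finally show ?thesis .
qed

text \<open>The mean is minus the derivative of the Laplace transform at \<open>0\<close>. With
  \<theta> = \<open>1 / (n + 1)\<close>, the quotients
  \<open>u n = (1 - exp (- \<theta> * D)) / \<theta>\<close> tend to \<open>D\<close> from below,
  and their expectations \<open>v n\<close> tend to \<open>b - a\<close>. Fatou's lemma gives one
  inequality and \<open>u n \<le> D\<close> the other.\<close>

lemma nn_integral_X_increment: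
  assumes "0 \<le> a" "a \<le> b"
  shows "(\<integral>\<^sup>+\<omega>. ennreal (X b \<omega> - X a \<omega>) \<partial>M) = ennreal (b - a)"
proof -
  define D where "D \<omega> = X b \<omega> - X a \<omega>" for \<omega>
  define u where "u n \<omega> = (real n + 1) * (1 - exp (- (1 / (real n + 1)) * D \<omega>))" for n \<omega>
  have [measurable]: "D \<in> borel_measurable M" unfolding D_def by measurable
  have [measurable]: "u n \<in> borel_measurable M" for n unfolding u_def by measurable
  have D0: "0 \<le> D \<omega>" for \<omega> using X_mono[OF assms(2)] by (simp add: D_def)
  have u0: "0 \<le> u n \<omega>" for n \<omega> using D0 by (simp add: u_def)
  have uD: "u n \<omega> \<le> D \<omega>" for n \<omega>
  proof -
    have "1 - exp (- (1 / (real n + 1)) * D \<omega>) \<le> (1 / (real n + 1)) * D \<omega>"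
      using exp_ge_add_one_self[of "- (1 / (real n + 1)) * D \<omega>"] by linarith
    then have "u n \<omega> \<le> (real n + 1) * ((1 / (real n + 1)) * D \<omega>)"
      unfolding u_def by (intro mult_left_mono) auto
    then show ?thesis by simp
  qed
  have ulim: "(\<lambda>n. u n \<omega>) \<longlonglongrightarrow> D \<omega>" for \<omega>
    unfolding u_def by real_asymp
  define v where "v n = (real n + 1) * (1 - (1 + 1 / (real n + 1)) powr (- (b - a)))" for n
  have vlim: "(\<lambda>n. ennreal (v n)) \<longlonglongrightarrow> ennreal (b - a)"
  proof (rule tendsto_ennrealI)
    show "v \<longlonglongrightarrow> b - a" unfolding v_def by real_asymp
  qed
  have Iu: "(\<integral>\<^sup>+\<omega>. ennreal (u n \<omega>) \<partial>M) = ennreal (v n)" for n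
  proof -
    have int: "integrable M (\<lambda>\<omega>. exp (- (1 / (real n + 1)) * D \<omega>))"
      using D0 by (intro integrable_const_bound[where B = 1]) auto
    have "expectation (\<lambda>\<omega>. exp (- (1 / (real n + 1)) * D \<omega>)) =
        expectation (\<lambda>\<omega>. exp (- (1 / (real n + 1)) * (S b \<omega> - S a \<omega>)))"
    proof (rule integral_cong_AE)
      have [measurable]: "S a \<in> borel_measurable M" "S b \<in> borel_measurable M"
        using assms by (auto intro: random_variable_S)
      show "(\<lambda>\<omega>. exp (- (1 / (real n + 1)) * (S b \<omega> - S a \<omega>))) \<in> borel_measurable M"
        by measurable
      show "AE \<omega> in M. exp (- (1 / (real n + 1)) * D \<omega>) = exp (- (1 / (real n + 1)) * (S b \<omega> - S a \<omega>))"
        using AE_X_eq_S[OF assms(1)] AE_X_eq_S[OF order_trans[OF assms]]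
        by eventually_elim (simp add: D_def)
    qed measurable
    also have "\<dots> = (1 + 1 / (real n + 1)) powr (- (b - a))"
      using assms by (intro expectation_exp_increment) auto
    finally have "expectation (u n) = v n"
      using int by (simp add: u_def[abs_def] v_def prob_space)
    moreover have "integrable M (u n)" unfolding u_def[abs_def] using int by simp
    ultimately show ?thesis using u0 by (simp add: nn_integral_eq_integral)
  qed
  show ?thesis
  proof (rule antisym)
    have "(\<integral>\<^sup>+\<omega>. ennreal (D \<omega>) \<partial>M) = (\<integral>\<^sup>+\<omega>. liminf (\<lambda>n. ennreal (u n \<omega>)) \<partial>M)"
      by (intro nn_integral_cong lim_imp_Liminf[symmetric] tendsto_ennrealI ulim) auto
    also have "\<dots> \<le> liminf (\<lambda>n. \<integral>\<^sup>+\<omega>. ennreal (u n \<omega>) \<partial>M)"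
      by (intro nn_integral_liminf) auto
    also have "\<dots> = ennreal (b - a)"
      unfolding Iu by (intro lim_imp_Liminf vlim) simp
    finally show "(\<integral>\<^sup>+\<omega>. ennreal (X b \<omega> - X a \<omega>) \<partial>M) \<le> ennreal (b - a)" by (simp add: D_def)
    have "ennreal (v n) \<le> (\<integral>\<^sup>+\<omega>. ennreal (D \<omega>) \<partial>M)" for n
      unfolding Iu[symmetric] by (intro nn_integral_mono ennreal_leI uD)
    then show "ennreal (b - a) \<le> (\<integral>\<^sup>+\<omega>. ennreal (X b \<omega> - X a \<omega>) \<partial>M)"
      unfolding D_def by (intro LIMSEQ_le_const2[OF vlim]) auto
  qed
qed

text \<open>A Dynkin argument on the intersection-stable generator of half-open intervals, where the
  claim is the mean of an increment. Measurability in \<open>\<omega>\<close> is part of the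
  induction, since the steps for complements and disjoint unions exchange integrals with differences
  and sums.\<close>

lemma emeasure_\<kappa>_mean:
  assumes t: "0 \<le> t" and A: "A \<in> sets borel"
  shows "(\<lambda>\<omega>. emeasure (\<kappa> \<omega>) (A \<inter> {0<..t})) \<in> borel_measurable M \<and>
    (\<integral>\<^sup>+\<omega>. emeasure (\<kappa> \<omega>) (A \<inter> {0<..t}) \<partial>M) = emeasure lborel (A \<inter> {0<..t})"
proof -
  let ?P = "\<lambda>A. (\<lambda>\<omega>. emeasure (\<kappa> \<omega>) (A \<inter> {0<..t})) \<in> borel_measurable M \<and>
    (\<integral>\<^sup>+\<omega>. emeasure (\<kappa> \<omega>) (A \<inter> {0<..t}) \<partial>M) = emeasure lborel (A \<inter> {0<..t})"
  let ?E = "range (\<lambda>(a, b). {a<..b::real})"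
  have basic: "?P {a<..b}" for a b
  proof (cases "max 0 a \<le> min t b")
    case True
    define l r where lr: "l = max 0 a" "r = min t b"
    have eq: "{a<..b} \<inter> {0<..t} = {l<..r}" by (auto simp: lr)
    have "0 \<le> l" "l \<le> r" using True by (simp_all add: lr)
    then show ?thesis unfolding eq
      by (simp add: emeasure_\<kappa>_Ioc nn_integral_X_increment)
  next
    case False
    then have eq: "{a<..b} \<inter> {0<..t} = {}" by auto
    show ?thesis unfolding eq by simp
  qed
  have whole: "?P UNIV"
    using basic[of 0 t] by (simp only: Int_absorb Int_UNIV_left)
  have A': "A \<in> sigma_sets UNIV ?E"
    using A by (simp add: borel_sigma_sets_Ioc)
  have borel: "B \<in> sigma_sets UNIV ?E \<Longrightarrow> B \<in> sets borel" for B
    by (simp add: borel_sigma_sets_Ioc)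
  have "Int_stable ?E"
  proof (rule Int_stableI)
    fix U V assume "U \<in> ?E" "V \<in> ?E"
    then obtain a b c d where "U = {a<..b}" "V = {c<..d}" by auto
    then have "U \<inter> V = (\<lambda>(a, b). {a<..b}) (max a c, min b d)" by auto
    then show "U \<inter> V \<in> ?E" by blast
  qed
  moreover have "?E \<subseteq> Pow UNIV" by simp
  ultimately show "?P A" using A'
  proof (induction rule: sigma_sets_induct_disjoint)
    case (basic U)
    then show ?case using \<open>\<And>a b. ?P {a<..b}\<close> by auto
  next
    case (compl U)
    note U [measurable] = borel[OF compl(1)]
    \<comment> \<open>Cutting down to \<open>{0<..t}\<close> makes all measures involved finite,
      which subtraction in \<open>ennreal\<close> requires.\<close>
    have Diff: "emeasure N ((UNIV - U) \<inter> {0<..t}) = emeasure N (UNIV \<inter> {0<..t}) - emeasure N (U \<inter> {0<..t})"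
      if "sets N = sets borel" "emeasure N {0<..t} < \<infinity>" for N
    proof -
      have "(UNIV - U) \<inter> {0<..t} = UNIV \<inter> {0<..t} - U \<inter> {0<..t}" by auto
      moreover have "emeasure N (U \<inter> {0<..t}) \<noteq> \<infinity>"
        using that emeasure_mono[of "U \<inter> {0<..t}" "{0<..t}" N] by (auto simp: top_unique)
      ultimately show ?thesis using that U by (simp add: emeasure_Diff)
    qed
    have fin: "emeasure (\<kappa> \<omega>) {0<..t} < \<infinity>" for \<omega>
      using t by (simp add: emeasure_\<kappa>_Ioc)
    have finl: "emeasure lborel {0<..t} < \<infinity>" using t by simp
    have "emeasure lborel (U \<inter> {0<..t}) \<le> emeasure lborel {0<..t}"
      by (intro emeasure_mono) auto
    then have finU: "emeasure lborel (U \<inter> {0<..t}) \<noteq> \<infinity>"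
      using finl by (auto simp: top_unique)
    show ?case
      unfolding Diff[OF sets_\<kappa> fin] Diff[OF sets_lborel finl]
      using whole compl(2) finU
      by (subst nn_integral_diff) (auto intro!: AE_I2 emeasure_mono)
  next
    case (union U)
    have U [measurable]: "U i \<in> sets borel" for i using union(2) borel by blast
    have UN: "emeasure N ((\<Union>i. U i) \<inter> {0<..t}) = (\<Sum>i. emeasure N (U i \<inter> {0<..t}))"
      if "sets N = sets borel" for N
    proof -
      have "(\<Union>i. U i) \<inter> {0<..t} = (\<Union>i. U i \<inter> {0<..t})" by auto
      then show ?thesis
        using union(1) that U by (subst suminf_emeasure) (auto simp: disjoint_family_on_def)
    qed
    have [measurable]: "(\<lambda>\<omega>. emeasure (\<kappa> \<omega>) (U i \<inter> {0<..t})) \<in> borel_measurable M" for i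
      using union(3) by blast
    show ?case
      unfolding UN[OF sets_\<kappa>] UN[OF sets_lborel] using union(3)
      by (simp add: nn_integral_suminf)
  qed auto
qed

text \<open>Campbell's formula for the mean: the passage from sets to nonnegative functions by
  linearity and monotone limits, again with measurability carried along.\<close>

lemma nn_integral_\<kappa>_mean:
  assumes t: "0 \<le> t" and h: "h \<in> borel_measurable borel"
  shows "(\<lambda>\<omega>. \<integral>\<^sup>+x. h x * indicator {0<..t} x \<partial>\<kappa> \<omega>) \<in> borel_measurable M \<and>
    (\<integral>\<^sup>+\<omega>. (\<integral>\<^sup>+x. h x * indicator {0<..t} x \<partial>\<kappa> \<omega>) \<partial>M) =
    (\<integral>\<^sup>+x. h x * indicator {0<..t} x \<partial>lborel)"
  using h
proof (induction rule: borel_measurable_induct)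
  case (cong f g)
  then have "f = g" by auto
  then show ?case using cong by simp
next
  case (set A)
  have "(\<integral>\<^sup>+x. indicator A x * indicator {0<..t} x \<partial>N) = emeasure N (A \<inter> {0<..t})"
    if "sets N = sets borel" for N
    using that set by (simp add: indicator_inter_arith[symmetric])
  from this[OF sets_\<kappa>] this[OF sets_lborel] show ?case
    using emeasure_\<kappa>_mean[OF t set] by simp
next
  case (mult u c)
  have "(\<integral>\<^sup>+x. c * u x * indicator {0<..t} x \<partial>N) = c * (\<integral>\<^sup>+x. u x * indicator {0<..t} x \<partial>N)"
    if "sets N = sets borel" for N
    using that mult by (simp add: mult.assoc nn_integral_cmult cong: measurable_cong_sets)
  note eq = this[OF sets_\<kappa>] this[OF sets_lborel]
  have [measurable]: "(\<lambda>\<omega>. \<integral>\<^sup>+x. u x * indicator {0<..t} x \<partial>\<kappa> \<omega>) \<in> borel_measurable M"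
    using mult.IH by blast
  show ?case
    unfolding eq using mult.IH by (simp add: nn_integral_cmult)
next
  case (add u v)
  have "(\<integral>\<^sup>+x. (v x + u x) * indicator {0<..t} x \<partial>N) =
      (\<integral>\<^sup>+x. v x * indicator {0<..t} x \<partial>N) + (\<integral>\<^sup>+x. u x * indicator {0<..t} x \<partial>N)"
    if "sets N = sets borel" for N
    using that add by (simp add: distrib_right nn_integral_add cong: measurable_cong_sets)
  note eq = this[OF sets_\<kappa>] this[OF sets_lborel]
  have [measurable]: "(\<lambda>\<omega>. \<integral>\<^sup>+x. u x * indicator {0<..t} x \<partial>\<kappa> \<omega>) \<in> borel_measurable M"
    "(\<lambda>\<omega>. \<integral>\<^sup>+x. v x * indicator {0<..t} x \<partial>\<kappa> \<omega>) \<in> borel_measurable M"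
    using add.IH by blast+
  show ?case
    unfolding eq using add.IH by (simp add: nn_integral_add)
next
  case (seq U)
  have U: "incseq (\<lambda>i x. U i x * indicator {0<..t} x)"
    using seq(3) by (auto simp: incseq_def le_fun_def intro!: mult_right_mono)
  have "(\<integral>\<^sup>+x. (SUP i. U i) x * indicator {0<..t} x \<partial>N) = (SUP i. \<integral>\<^sup>+x. U i x * indicator {0<..t} x \<partial>N)"
    if "sets N = sets borel" for N
  proof -
    have "(SUP i. U i) x * indicator {0<..t} x = (SUP i. U i x * indicator {0<..t} x)" for x
      by (simp add: SUP_mult_right_ennreal image_comp)
    then show ?thesis
      using that seq U by (simp add: nn_integral_monotone_convergence_SUP cong: measurable_cong_sets)
  qed
  note SUP = this[OF sets_\<kappa>] this[OF sets_lborel]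
  have "incseq (\<lambda>i \<omega>. \<integral>\<^sup>+x. U i x * indicator {0<..t} x \<partial>\<kappa> \<omega>)"
    using U by (auto simp: incseq_def le_fun_def intro!: nn_integral_mono)
  moreover have [measurable]: "(\<lambda>\<omega>. \<integral>\<^sup>+x. U i x * indicator {0<..t} x \<partial>\<kappa> \<omega>) \<in> borel_measurable M" for i
    using seq.IH by blast
  ultimately show ?case
    unfolding SUP using seq.IH by (simp add: nn_integral_monotone_convergence_SUP)
qed

text \<open>A Lebesgue null set has path measure of mean \<open>0\<close> on \<open>{0<..t}\<close>,
  and a nonnegative variable of mean \<open>0\<close> vanishes almost surely. This permits
  integrands to be altered on Lebesgue null sets.\<close>

lemma AE_\<kappa>:
  assumes t: "0 \<le> t" and ae: "AE x in lborel. P x"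
  shows "AE \<omega> in M. AE x in \<kappa> \<omega>. x \<in> {0<..t} \<longrightarrow> P x"
proof -
  obtain N where N: "{x. \<not> P x} \<subseteq> N" "emeasure lborel N = 0" "N \<in> sets borel"
    using AE_E[OF ae] by auto
  have "emeasure lborel (N \<inter> {0<..t}) \<le> emeasure lborel N"
    using N by (intro emeasure_mono) auto
  then have "(\<integral>\<^sup>+\<omega>. emeasure (\<kappa> \<omega>) (N \<inter> {0<..t}) \<partial>M) = 0"
    using emeasure_\<kappa>_mean[OF t N(3)] N(2) by simp
  moreover have "(\<lambda>\<omega>. emeasure (\<kappa> \<omega>) (N \<inter> {0<..t})) \<in> borel_measurable M"
    using emeasure_\<kappa>_mean[OF t N(3)] by blast
  ultimately have "AE \<omega> in M. emeasure (\<kappa> \<omega>) (N \<inter> {0<..t}) = 0"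
    by (simp add: nn_integral_0_iff_AE)
  then show ?thesis
  proof eventually_elim
    case (elim \<omega>)
    then show ?case
      using N by (intro AE_I[where N = "N \<inter> {0<..t}"]) auto
  qed
qed

text \<open>The integral of \<open>\<bar>w\<bar>\<close> against \<open>\<kappa> \<omega>\<close>
  has finite mean by Campbell's formula, so it is almost surely finite.\<close>

lemma AE_set_integrable_\<kappa>:
  fixes w :: "real \<Rightarrow> real"
  assumes t: "0 \<le> t" and w [measurable]: "w \<in> borel_measurable borel"
    and int: "set_integrable lborel {0<..t} w"
  shows "AE \<omega> in M. set_integrable (\<kappa> \<omega>) {0<..t} w"
proof -
  have norm: "ennreal (norm (indicator {0<..t} x *\<^sub>R w x)) = ennreal \<bar>w x\<bar> * indicator {0<..t} x" for x
    by (simp add: indicator_def)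
  have mean: "(\<lambda>\<omega>. \<integral>\<^sup>+x. ennreal \<bar>w x\<bar> * indicator {0<..t} x \<partial>\<kappa> \<omega>) \<in> borel_measurable M"
    "(\<integral>\<^sup>+\<omega>. (\<integral>\<^sup>+x. ennreal \<bar>w x\<bar> * indicator {0<..t} x \<partial>\<kappa> \<omega>) \<partial>M) =
      (\<integral>\<^sup>+x. ennreal \<bar>w x\<bar> * indicator {0<..t} x \<partial>lborel)"
    using nn_integral_\<kappa>_mean[OF t, of "\<lambda>x. ennreal \<bar>w x\<bar>"] by auto
  have "(\<integral>\<^sup>+x. ennreal \<bar>w x\<bar> * indicator {0<..t} x \<partial>lborel) < \<infinity>"
    using int unfolding set_integrable_def integrable_iff_bounded norm by simp
  then have "AE \<omega> in M. (\<integral>\<^sup>+x. ennreal \<bar>w x\<bar> * indicator {0<..t} x \<partial>\<kappa> \<omega>) \<noteq> \<infinity>"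
    using mean by (intro nn_integral_PInf_AE) auto
  then show ?thesis
    unfolding set_integrable_def integrable_iff_bounded norm
    by eventually_elim (simp add: top.not_eq_extremum)
qed

lemma \<kappa>_integral_measurable:
  assumes t: "0 \<le> t" and h [measurable]: "h \<in> borel_measurable borel"
    and h0: "\<And>x. 0 \<le> (h x :: real)"
  shows "(\<lambda>\<omega>. LINT x:{0<..t}|\<kappa> \<omega>. h x) \<in> borel_measurable M"
proof -
  \<comment> \<open>This is valid also where the integral is infinite: the Bochner integral and
    \<open>enn2real\<close> then both default to \<open>0\<close>.\<close>
  have "(LINT x:{0<..t}|\<kappa> \<omega>. h x) = enn2real (\<integral>\<^sup>+x. ennreal (h x) * indicator {0<..t} x \<partial>\<kappa> \<omega>)" for \<omega>
    unfolding set_lebesgue_integral_def using h0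
    by (subst integral_eq_nn_integral) (auto intro!: arg_cong[where f = enn2real] nn_integral_cong simp: indicator_def)
  moreover have [measurable]: "(\<lambda>\<omega>. \<integral>\<^sup>+x. ennreal (h x) * indicator {0<..t} x \<partial>\<kappa> \<omega>) \<in> borel_measurable M"
    using nn_integral_\<kappa>_mean[OF t, of "\<lambda>x. ennreal (h x)"] by simp
  ultimately show ?thesis by simp
qed

lemma \<kappa>_integral_nonneg:
  fixes h :: "real \<Rightarrow> real"
  assumes "\<And>x. 0 \<le> h x"
  shows "0 \<le> (LINT x:{0<..t}|\<kappa> \<omega>. h x)"
  unfolding set_lebesgue_integral_def using assms by (intro Bochner_Integration.integral_nonneg) simp

section \<open>The Laplace functional of the path integral\<close>

definition laplace_formula :: "real \<Rightarrow> (real \<Rightarrow> real) \<Rightarrow> bool" where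
  "laplace_formula t h \<longleftrightarrow>
     expectation (\<lambda>\<omega>. exp (- (LINT x:{0<..t}|\<kappa> \<omega>. h x))) = exp (- (LINT x:{0<..t}|lborel. ln (1 + h x)))"

text \<open>Both exponents are limits of Riemann sums on the uniform grid, of \<open>g\<close>
  against \<open>\<kappa> \<omega>\<close> and of \<open>ln (1 + g)\<close> against Lebesgue
  measure. At every finite stage the two sides coincide by
  \<open>expectation_exp_sum_increments\<close>. The limit passes through the expectation because
  \<open>exp (- R n \<omega>)\<close> is bounded by \<open>1\<close>.\<close>

lemma laplace_formula_continuous:
  assumes t: "0 < t" and g: "continuous_on UNIV g" and g0: "\<And>x. 0 \<le> g x"
  shows "laplace_formula t g"
proof -
  have [measurable]: "g \<in> borel_measurable borel"
    using g by (simp add: borel_measurable_continuous_onI)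
  define ts where "ts n i = t * real i / real n" for n i
  define c where "c n i = g (ts n (Suc i))" for n i
  have ts0: "0 \<le> ts n 0" for n by (simp add: ts_def)
  have ts_mono: "mono (ts n)" for n
    using t by (auto simp: mono_def ts_def intro!: divide_right_mono mult_left_mono)
  have step: "ts n i \<le> ts n (Suc i)" for n i using monoD[OF ts_mono] by simp
  have c0: "0 \<le> c n i" for n i using g0 by (simp add: c_def)
  define R where "R n \<omega> = (\<Sum>i<n. c n i * (X (ts n (Suc i)) \<omega> - X (ts n i) \<omega>))" for n \<omega>
  have [measurable]: "R n \<in> borel_measurable M" for n unfolding R_def by measurable
  have R0: "0 \<le> R n \<omega>" for n \<omega>
    unfolding R_def using c0 X_mono[OF step] by (intro sum_nonneg mult_nonneg_nonneg) auto
  have Rlim: "(\<lambda>n. R n \<omega>) \<longlonglongrightarrow> (LINT x:{0<..t}|\<kappa> \<omega>. g x)" for \<omega>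
  proof -
    have "emeasure (\<kappa> \<omega>) {0<..t} < \<infinity>" using t by (simp add: emeasure_\<kappa>_Ioc)
    from Riemann_sums_tendsto_integral[OF sets_\<kappa> this t g]
    show ?thesis
      using measure_\<kappa>_Ioc[OF step] by (simp add: R_def c_def ts_def)
  qed
  have "(\<lambda>n. expectation (\<lambda>\<omega>. exp (- R n \<omega>))) \<longlonglongrightarrow>
      expectation (\<lambda>\<omega>. exp (- (LINT x:{0<..t}|\<kappa> \<omega>. g x)))"
  proof (rule integral_dominated_convergence[where w = "\<lambda>_. 1"])
    show "(\<lambda>\<omega>. exp (- (LINT x:{0<..t}|\<kappa> \<omega>. g x))) \<in> borel_measurable M"
      using t g0 \<kappa>_integral_measurable[of t g] by simp
    show "AE \<omega> in M. (\<lambda>n. exp (- R n \<omega>)) \<longlonglongrightarrow> exp (- (LINT x:{0<..t}|\<kappa> \<omega>. g x))"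
      by (intro AE_I2 tendsto_intros Rlim)
  qed (use R0 in auto)
  moreover have "(\<lambda>n. expectation (\<lambda>\<omega>. exp (- R n \<omega>))) \<longlonglongrightarrow>
      exp (- (LINT x:{0<..t}|lborel. ln (1 + g x)))"
  proof -
    have pos: "1 + g x \<noteq> 0" "0 < 1 + g x" for x using g0[of x] by linarith+
    have "continuous_on UNIV (\<lambda>x. ln (1 + g x))"
      using g pos by (intro continuous_intros) auto
    from Riemann_sums_tendsto_integral[OF sets_lborel _ t this]
    have "(\<lambda>n. \<Sum>i<n. ln (1 + c n i) * (ts n (Suc i) - ts n i)) \<longlonglongrightarrow>
        (LINT x:{0<..t}|lborel. ln (1 + g x))"
      using t step by (simp add: c_def ts_def)
    then have "(\<lambda>n. exp (- (\<Sum>i<n. ln (1 + c n i) * (ts n (Suc i) - ts n i)))) \<longlonglongrightarrow>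
        exp (- (LINT x:{0<..t}|lborel. ln (1 + g x)))"
      by (intro tendsto_intros)
    moreover have "exp (- (\<Sum>i<n. ln (1 + c n i) * (ts n (Suc i) - ts n i))) =
        expectation (\<lambda>\<omega>. exp (- R n \<omega>))" for n
    proof -
      \<comment> \<open>This excludes base \<open>0\<close>, where \<open>powr\<close> is
        \<open>0\<close> by convention instead of an exponential.\<close>
      have "1 + c n i \<noteq> 0" for i using pos by (simp add: c_def)
      then show ?thesis
        unfolding R_def expectation_exp_sum_increments[OF ts0 ts_mono c0]
        by (simp add: exp_sum sum_negf[symmetric] powr_def mult.commute minus_mult_right)
    qed
    ultimately show ?thesis by simp
  qed
  ultimately show ?thesis
    unfolding laplace_formula_def by (rule LIMSEQ_unique)
qed

text \<open>On the left, dominated convergence is used twice: under \<open>\<kappa> \<omega>\<close>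
  for almost every \<open>\<omega>\<close>, where \<open>AE_\<kappa>\<close> and
  \<open>AE_set_integrable_\<kappa>\<close> transfer the limit and the majorant from Lebesgue
  measure, and then under \<open>M\<close>, where the exponentials are bounded by \<open>1\<close>.
  On the right, \<open>0 \<le> ln (1 + u n x) \<le> u n x \<le> w x\<close> gives the
  majorant.\<close>

lemma laplace_formula_dominated_limit:
  assumes t: "0 \<le> t"
    and [measurable]: "\<And>n. u n \<in> borel_measurable borel" "h \<in> borel_measurable borel"
      "w \<in> borel_measurable borel"
    and u0: "\<And>n x. 0 \<le> u n x" and h0: "\<And>x. 0 \<le> h x"
    and uw: "\<And>n x. u n x \<le> w x"
    and w: "set_integrable lborel {0<..t} w"
    and lim: "AE x in lborel. (\<lambda>n. u n x) \<longlonglongrightarrow> h x"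
    and u: "\<And>n. laplace_formula t (u n)"
  shows "laplace_formula t h"
proof -
  have wI: "integrable lborel (\<lambda>x. indicator {0<..t} x * w x)"
    using w by (simp add: set_integrable_def)
  have "(\<lambda>n. expectation (\<lambda>\<omega>. exp (- (LINT x:{0<..t}|\<kappa> \<omega>. u n x)))) \<longlonglongrightarrow>
      expectation (\<lambda>\<omega>. exp (- (LINT x:{0<..t}|\<kappa> \<omega>. h x)))"
  proof (rule integral_dominated_convergence[where w = "\<lambda>_. 1"])
    show "AE \<omega> in M. (\<lambda>n. exp (- (LINT x:{0<..t}|\<kappa> \<omega>. u n x))) \<longlonglongrightarrow>
        exp (- (LINT x:{0<..t}|\<kappa> \<omega>. h x))"
      using AE_\<kappa>[OF t lim] AE_set_integrable_\<kappa>[OF t _ w, simplified]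
    proof eventually_elim
      case (elim \<omega>)
      have "(\<lambda>n. LINT x:{0<..t}|\<kappa> \<omega>. u n x) \<longlonglongrightarrow> (LINT x:{0<..t}|\<kappa> \<omega>. h x)"
        unfolding set_lebesgue_integral_def real_scaleR_def
      proof (rule integral_dominated_convergence[where w = "\<lambda>x. indicator {0<..t} x * w x"])
        show "AE x in \<kappa> \<omega>. (\<lambda>n. indicator {0<..t} x * u n x) \<longlonglongrightarrow> indicator {0<..t} x * h x"
          using elim(1) by eventually_elim (auto simp: indicator_def)
        show "AE x in \<kappa> \<omega>. norm (indicator {0<..t} x * u n x) \<le> indicator {0<..t} x * w x" for n
          using u0 uw by (intro AE_I2) (auto simp: indicator_def)
      qed (use elim(2) in \<open>auto simp: set_integrable_def\<close>)
      then show ?case by (intro tendsto_intros)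
    qed
    have [measurable]: "(\<lambda>\<omega>. LINT x:{0<..t}|\<kappa> \<omega>. h x) \<in> borel_measurable M"
        "(\<lambda>\<omega>. LINT x:{0<..t}|\<kappa> \<omega>. u n x) \<in> borel_measurable M" for n
      using t u0 h0 by (intro \<kappa>_integral_measurable; simp)+
    show "(\<lambda>\<omega>. exp (- (LINT x:{0<..t}|\<kappa> \<omega>. h x))) \<in> borel_measurable M"
        "(\<lambda>\<omega>. exp (- (LINT x:{0<..t}|\<kappa> \<omega>. u n x))) \<in> borel_measurable M" for n
      by measurable
    show "AE \<omega> in M. norm (exp (- (LINT x:{0<..t}|\<kappa> \<omega>. u n x))) \<le> 1" for n
      using \<kappa>_integral_nonneg[OF u0] by simp
  qed simp
  moreover have "(\<lambda>n. exp (- (LINT x:{0<..t}|lborel. ln (1 + u n x)))) \<longlonglongrightarrow>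
      exp (- (LINT x:{0<..t}|lborel. ln (1 + h x)))"
    unfolding set_lebesgue_integral_def real_scaleR_def
  proof (intro tendsto_intros integral_dominated_convergence[where w = "\<lambda>x. indicator {0<..t} x * w x"])
    show "AE x in lborel. (\<lambda>n. indicator {0<..t} x * ln (1 + u n x)) \<longlonglongrightarrow> indicator {0<..t} x * ln (1 + h x)"
      using lim
    proof eventually_elim
      case (elim x)
      have "1 + h x \<noteq> 0" using h0[of x] by linarith
      then show ?case by (intro tendsto_intros elim)
    qed
    have "0 \<le> ln (1 + u n x)" "ln (1 + u n x) \<le> w x" for n x
      using u0[of n x] uw[of n x] ln_add_one_self_le_self[of "u n x"] by auto
    then show "AE x in lborel. norm (indicator {0<..t} x * ln (1 + u n x)) \<le> indicator {0<..t} x * w x" for n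
      by (intro AE_I2) (auto simp: indicator_def)
  qed (use wI in auto)
  ultimately show ?thesis
    using u unfolding laplace_formula_def by (simp add: LIMSEQ_unique)
qed

text \<open>A measurable function is an almost everywhere limit of continuous ones. Clipping these
  to the range from \<open>0\<close> to \<open>B\<close> keeps continuity and the limit, and yields
  the constant majorant \<open>B\<close>.\<close>

lemma laplace_formula_bounded:
  assumes t: "0 < t" and [measurable]: "u \<in> borel_measurable borel"
    and u: "\<And>x. 0 \<le> u x" "\<And>x. u x \<le> B"
  shows "laplace_formula t u"
proof -
  have "u \<in> borel_measurable lebesgue" by (simp add: measurable_completion)
  then have "u measurable_on UNIV"
    by (intro lebesgue_measurable_imp_measurable_on_real) auto
  then obtain N g where N: "negligible N" and g: "\<And>n. continuous_on UNIV (g n)"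
    and lim: "\<And>x. x \<notin> N \<Longrightarrow> (\<lambda>n. g n x) \<longlonglongrightarrow> u x"
    unfolding measurable_on_def by auto
  have B: "0 \<le> B" using u[of 0] by linarith
  have cont: "continuous_on UNIV (\<lambda>x. max 0 (min B (g n x)))" for n
    using g by (intro continuous_intros)
  have "AE x in lebesgue. x \<notin> N"
    using N by (intro AE_not_in) (simp add: negligible_iff_null_sets)
  then have "AE x in lborel. x \<notin> N" by (simp add: AE_completion_iff)
  then have lim': "AE x in lborel. (\<lambda>n. max 0 (min B (g n x))) \<longlonglongrightarrow> u x"
  proof eventually_elim
    case (elim x)
    have "(\<lambda>n. max 0 (min B (g n x))) \<longlonglongrightarrow> max 0 (min B (u x))"
      by (intro tendsto_intros lim elim)
    then show ?case using u[of x] by simp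
  qed
  have "set_integrable lborel {0<..t} (\<lambda>_. B)"
    using t by (simp add: set_integrable_def)
  from laplace_formula_dominated_limit[OF _ _ _ _ _ u(1) _ this lim'] show ?thesis
    using t B cont by (simp add: laplace_formula_continuous borel_measurable_continuous_onI)
qed

text \<open>Truncation at level \<open>n\<close> reduces to the bounded case: at each point the
  truncations are eventually equal to \<open>h\<close>, and \<open>h\<close> itself is an integrable
  majorant.\<close>

lemma laplace_formula_integrable:
  assumes t: "0 < t" and [measurable]: "h \<in> borel_measurable borel" and h0: "\<And>x. 0 \<le> h x"
    and int: "set_integrable lborel {0<..t} h"
  shows "laplace_formula t h"
proof -
  have "(\<lambda>n. min (h x) (real n)) \<longlonglongrightarrow> h x" for x
  proof (rule tendsto_eventually)
    show "\<forall>\<^sub>F n in sequentially. min (h x) (real n) = h x"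
      using eventually_ge_at_top[of "nat \<lceil>h x\<rceil>"]
      by eventually_elim (simp add: nat_ceiling_le_eq)
  qed
  then have lim: "AE x in lborel. (\<lambda>n. min (h x) (real n)) \<longlonglongrightarrow> h x" by simp
  show ?thesis
  proof (rule laplace_formula_dominated_limit[where u = "\<lambda>n x. min (h x) (real n)" and w = h])
    show "laplace_formula t (\<lambda>x. min (h x) (real n))" for n
      using t h0 by (intro laplace_formula_bounded[where B = "real n"]) auto
  qed (use t h0 int lim in simp_all)
qed

text \<open>The integrand is only Lebesgue measurable, so it is replaced by a Borel function
  \<open>h\<close> that agrees with it almost everywhere on \<open>{0..t}\<close>; \<open>Y\<close>
  is the integral of \<open>h\<close>. By \<open>AE_\<kappa>\<close> the two also agree under almost
  every path measure. Thus \<open>Y\<close> is a Borel measurable version of the path integral, and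
  the transform is the Laplace formula for \<open>\<theta> * h\<close>.\<close>

lemma path_integral_laplace_regular:
  assumes t: "0 < t" and int: "f absolutely_integrable_on {0..t}"
    and f0: "\<And>x. 0 \<le> x \<Longrightarrow> 0 \<le> f x"
  shows "\<exists>Y\<in>borel_measurable M. (\<forall>\<omega>. 0 \<le> Y \<omega>) \<and> (AE \<omega> in M. path_integral S t f \<omega> = Y \<omega>) \<and>
    (\<forall>\<theta>\<ge>0. expectation (\<lambda>\<omega>. exp (- \<theta> * Y \<omega>)) = exp (- (LINT x:{0..t}|lebesgue. ln (1 + \<theta> * f x))))"
proof -
  have intf: "integrable lebesgue (\<lambda>x. indicator {0..t} x * f x)"
    using int by (simp add: set_integrable_def)
  from completion_ex_borel_measurable_real[OF borel_measurable_integrable[OF this]]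
  obtain h0 where [measurable]: "h0 \<in> borel_measurable borel"
    and h0: "AE x in lborel. indicator {0..t} x * f x = h0 x" by auto
  \<comment> \<open>Taking the positive part gives nonnegativity everywhere, as the Laplace formula
    demands, and changes \<open>h0\<close> only on a null set because \<open>f\<close> is
    nonnegative on \<open>{0..t}\<close>.\<close>
  define h where "h x = max 0 (h0 x)" for x
  have [measurable]: "h \<in> borel_measurable borel" unfolding h_def by measurable
  have hpos: "0 \<le> h x" for x by (simp add: h_def)
  have hf: "AE x in lborel. h x = indicator {0..t} x * f x"
    using h0
  proof eventually_elim
    case (elim x)
    have "0 \<le> h0 x"
      using f0[of x] elim[symmetric] by (simp add: indicator_def)
    then show ?case by (simp only: elim h_def max_absorb2)
  qed
  have "integrable lebesgue h"
  proof (rule integrable_cong_AE_imp[OF intf])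
    show "h \<in> borel_measurable lebesgue" by (rule measurable_completion) measurable
    show "AE x in lebesgue. indicator {0..t} x * f x = h x"
      using AE_completion[OF hf] by eventually_elim simp
  qed
  then have "integrable lborel h" by (simp add: integrable_completion)
  then have inth: "set_integrable lborel {0<..t} h"
    unfolding set_integrable_def by (intro integrable_mult_indicator) auto
  define Y where "Y \<omega> = (LINT x:{0<..t}|\<kappa> \<omega>. h x)" for \<omega>
  show ?thesis
  proof (intro bexI[of _ Y] conjI allI impI)
    show "Y \<in> borel_measurable M"
      unfolding Y_def using t hpos by (intro \<kappa>_integral_measurable) auto
    show "0 \<le> Y \<omega>" for \<omega>
      unfolding Y_def using hpos by (rule \<kappa>_integral_nonneg)
    show "AE \<omega> in M. path_integral S t f \<omega> = Y \<omega>"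
      using AE_G AE_\<kappa>[OF less_imp_le[OF t] hf]
    proof eventually_elim
      case (elim \<omega>)
      have ae: "AE x in \<kappa> \<omega>. indicator {0<..t} x *\<^sub>R f x = indicator {0<..t} x *\<^sub>R h x"
        using elim(2) by eventually_elim (auto simp: indicator_def)
      have "path_integral S t f \<omega> = (\<integral>x. indicator {0<..t} x *\<^sub>R f x \<partial>completion (\<kappa> \<omega>))"
        using elim(1) by (simp add: path_integral_def set_lebesgue_integral_def path_measure_eq_completion_\<kappa>)
      also have "\<dots> = (\<integral>x. indicator {0<..t} x *\<^sub>R h x \<partial>completion (\<kappa> \<omega>))"
      proof (rule integral_cong_AE)
        show "(\<lambda>x. indicator {0<..t} x *\<^sub>R f x) \<in> borel_measurable (completion (\<kappa> \<omega>))"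
          by (rule borel_measurable_completion_AE[OF _ ae]) measurable
        show "(\<lambda>x. indicator {0<..t} x *\<^sub>R h x) \<in> borel_measurable (completion (\<kappa> \<omega>))"
          by (rule measurable_completion) measurable
      qed (rule AE_completion[OF ae])
      also have "\<dots> = Y \<omega>"
        unfolding Y_def set_lebesgue_integral_def by (rule integral_completion) measurable
      finally show ?case .
    qed
    fix \<theta> :: real assume \<theta>: "0 \<le> \<theta>"
    have "laplace_formula t (\<lambda>x. \<theta> * h x)"
      using t \<theta> hpos inth by (intro laplace_formula_integrable) auto
    then have "expectation (\<lambda>\<omega>. exp (- \<theta> * Y \<omega>)) = exp (- (LINT x:{0<..t}|lborel. ln (1 + \<theta> * h x)))"
      by (simp add: laplace_formula_def Y_def)
    also have "(LINT x:{0<..t}|lborel. ln (1 + \<theta> * h x)) =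
        (\<integral>x. indicator {0<..t} x *\<^sub>R ln (1 + \<theta> * h x) \<partial>lebesgue)"
      unfolding set_lebesgue_integral_def by (rule integral_completion[symmetric]) measurable
    also have "\<dots> = (LINT x:{0..t}|lebesgue. ln (1 + \<theta> * f x))"
      unfolding set_lebesgue_integral_def
    proof (rule integral_cong_AE)
      \<comment> \<open>The Lebesgue integral runs over \<open>{0..t}\<close> and the path integral
        over \<open>{0<..t}\<close>; the point \<open>0\<close> that separates them is a Lebesgue
        null set.\<close>
      have "AE x in lborel. x \<noteq> (0::real)" by (rule AE_lborel_singleton)
      then have ae: "AE x in lborel. indicator {0..t} x *\<^sub>R ln (1 + \<theta> * f x) =
          indicator {0<..t} x *\<^sub>R ln (1 + \<theta> * h x)"
        using hf by eventually_elim (auto simp: indicator_def)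
      show "(\<lambda>x. indicator {0..t} x *\<^sub>R ln (1 + \<theta> * f x)) \<in> borel_measurable lebesgue"
        by (rule borel_measurable_completion_AE[OF _ ae]) measurable
      show "(\<lambda>x. indicator {0<..t} x *\<^sub>R ln (1 + \<theta> * h x)) \<in> borel_measurable lebesgue"
        by (rule measurable_completion) measurable
      show "AE x in lebesgue. indicator {0<..t} x *\<^sub>R ln (1 + \<theta> * h x) =
          indicator {0..t} x *\<^sub>R ln (1 + \<theta> * f x)"
        using AE_completion[OF ae] by eventually_elim simp
    qed
    finally show "expectation (\<lambda>\<omega>. exp (- \<theta> * Y \<omega>)) =
        exp (- (LINT x:{0..t}|lebesgue. ln (1 + \<theta> * f x)))" .
  qed
qed

end

section \<open>Consequences of orderly divergence for the Laplace functional\<close>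

context gamma_process
begin

text \<open>Finitely many almost sure path properties fail jointly only within one null set
  \<open>N\<close>; its complement serves as the good event of
  \<open>regular_gamma_process\<close>.\<close>

lemma path_integral_laplace:
  assumes "0 < t" "f absolutely_integrable_on {0..t}" "\<And>x. 0 \<le> x \<Longrightarrow> 0 \<le> f x"
  shows "\<exists>Y\<in>borel_measurable M. (\<forall>\<omega>. 0 \<le> Y \<omega>) \<and> (AE \<omega> in M. path_integral S t f \<omega> = Y \<omega>) \<and>
    (\<forall>\<theta>\<ge>0. expectation (\<lambda>\<omega>. exp (- \<theta> * Y \<omega>)) = exp (- (LINT x:{0..t}|lebesgue. ln (1 + \<theta> * f x))))"
proof -
  have "AE \<omega> in M. S 0 \<omega> = 0 \<and> mono_on {0..} (\<lambda>t. S t \<omega>) \<and>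
      (\<forall>t\<ge>0. continuous (at_right t) (\<lambda>s. S s \<omega>))" (is "AE \<omega> in M. ?P \<omega>")
    using S_zero increasing_paths right_continuous_paths by eventually_elim auto
  from AE_E3[OF this] obtain N where N: "\<And>\<omega>. \<omega> \<in> space M - N \<Longrightarrow> ?P \<omega>" "N \<in> null_sets M"
    by blast
  interpret regular_gamma_process M S "space M - N"
  proof
    show "AE \<omega> in M. \<omega> \<in> space M - N"
      using AE_not_in[OF N(2)] by auto
  qed (use N in auto)
  show ?thesis
    using assms by (rule path_integral_laplace_regular)
qed

text \<open>The map \<open>exp (- a)\<close> is bounded by \<open>1\<close> and 1-Lipschitz for
  \<open>a \<ge> 0\<close>, so convergence of the quotients to \<open>1\<close> in probability
  carries over to their expected exponentials. These are the Laplace transforms of the path integral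
  at \<open>\<theta> = 1 / lam t f\<close>.\<close>

lemma orderly_divergence_imp_laplace_tendsto:
  assumes od: "orderly_divergence M S f"
    and loc: "locally_integrable f" and f0: "\<And>x. 0 \<le> x \<Longrightarrow> 0 \<le> f x"
    and div: "filterlim (\<lambda>t. lam t f) at_top at_top"
  shows "((\<lambda>t. exp (- (LINT x:{0..t}|lebesgue. ln (1 + f x / lam t f)))) \<longlongrightarrow> exp (- 1)) at_top"
proof (rule tendstoI)
  fix \<delta> :: real assume \<delta>: "0 < \<delta>"
  \<comment> \<open>One half of \<open>\<delta>\<close> pays for the deviation off the exceptional
    event \<open>A\<close>, the other half for the probability of \<open>A\<close>.\<close>
  define \<epsilon> where "\<epsilon> = \<delta> / 2"
  have \<epsilon>: "0 < \<epsilon>" using \<delta> by (simp add: \<epsilon>_def)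
  let ?p = "\<lambda>t. measure (completion M) {\<omega> \<in> space M. \<bar>path_integral S t f \<omega> / lam t f - 1\<bar> > \<epsilon>}"
  have "(?p \<longlongrightarrow> 0) at_top"
    using od \<epsilon> unfolding orderly_divergence_def converges_in_probability_def by blast
  then have "\<forall>\<^sub>F t in at_top. ?p t < \<epsilon>"
    using \<epsilon> by (rule order_tendstoD)
  moreover have "\<forall>\<^sub>F t in at_top. 0 < lam t f"
    using div by (simp add: filterlim_at_top_dense)
  ultimately show "\<forall>\<^sub>F t in at_top. dist (exp (- (LINT x:{0..t}|lebesgue. ln (1 + f x / lam t f)))) (exp (- 1)) < \<delta>"
    using eventually_gt_at_top[of 0]
  proof eventually_elim
    case (elim t)
    have "f absolutely_integrable_on {0..t}"
      using loc elim by (simp add: locally_integrable_def)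
    from path_integral_laplace[OF elim(3) this f0]
    obtain Y where [measurable]: "Y \<in> borel_measurable M" and Y0: "\<And>\<omega>. 0 \<le> Y \<omega>"
      and Y: "AE \<omega> in M. path_integral S t f \<omega> = Y \<omega>"
      and lap: "\<And>\<theta>. 0 \<le> \<theta> \<Longrightarrow> expectation (\<lambda>\<omega>. exp (- \<theta> * Y \<omega>)) =
        exp (- (LINT x:{0..t}|lebesgue. ln (1 + \<theta> * f x)))"
      by auto
    define R where "R \<omega> = Y \<omega> / lam t f" for \<omega>
    define A where "A = {\<omega> \<in> space M. \<bar>R \<omega> - 1\<bar> > \<epsilon>}"
    have [measurable]: "R \<in> borel_measurable M" unfolding R_def by measurable
    have A [measurable]: "A \<in> sets M" unfolding A_def by measurable
    have R0: "0 \<le> R \<omega>" for \<omega> using Y0 elim by (simp add: R_def)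
    \<comment> \<open>The hypothesis speaks of the path integral itself, whose event is measurable
      only in the completion. It agrees almost surely with \<open>A\<close>, the event formed from
      the measurable version.\<close>
    have "measure M A = measure (completion M) A" using A by simp
    also have "\<dots> = ?p t"
    proof (rule measure_eq_AE)
      show ae: "AE \<omega> in completion M. \<omega> \<in> A \<longleftrightarrow>
          \<omega> \<in> {\<omega> \<in> space M. \<bar>path_integral S t f \<omega> / lam t f - 1\<bar> > \<epsilon>}"
        using AE_completion[OF Y] by eventually_elim (simp add: A_def R_def)
      show "A \<in> sets (completion M)" using A by simp
      then show "{\<omega> \<in> space M. \<bar>path_integral S t f \<omega> / lam t f - 1\<bar> > \<epsilon>} \<in> sets (completion M)"
        using ae by (intro completion.in_sets_AE[OF ae]) auto
    qed
    finally have prob_A: "prob A < \<epsilon>" using elim by simp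
    have lip: "\<bar>exp (- a) - exp (- 1)\<bar> \<le> \<bar>a - 1\<bar>" if "0 \<le> a" for a :: real
    proof -
      have *: "exp (- x) - exp (- y) \<le> y - x" if "0 \<le> x" "x \<le> y" for x y :: real
      proof -
        have "exp (- x) - exp (- y) = exp (- x) * (1 - exp (- (y - x)))"
          by (simp add: right_diff_distrib mult_exp_exp)
        also have "\<dots> \<le> 1 * (y - x)"
          using that exp_ge_add_one_self[of "x - y"] by (intro mult_mono) (auto simp: algebra_simps)
        finally show ?thesis by simp
      qed
      show ?thesis using *[of a 1] *[of 1 a] that by (cases "a \<le> 1") auto
    qed
    have intR: "integrable M (\<lambda>\<omega>. exp (- R \<omega>))"
      using R0 by (intro integrable_const_bound[where B = 1]) auto
    have bound: "\<bar>exp (- R \<omega>) - exp (- 1)\<bar> \<le> \<epsilon> + indicator A \<omega>" if "\<omega> \<in> space M" for \<omega>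
    proof (cases "\<omega> \<in> A")
      case True
      have "0 < exp (- R \<omega>)" "exp (- R \<omega>) \<le> 1" "0 < exp (- 1 :: real)" "exp (- 1 :: real) \<le> 1"
        using R0 by auto
      then have "\<bar>exp (- R \<omega>) - exp (- 1)\<bar> \<le> 1" by linarith
      then show ?thesis using True \<epsilon> by simp
    next
      case False
      then have "\<bar>R \<omega> - 1\<bar> \<le> \<epsilon>" using that by (simp add: A_def)
      then show ?thesis using False lip[OF R0, of \<omega>] by simp
    qed
    have "\<bar>expectation (\<lambda>\<omega>. exp (- R \<omega>)) - exp (- 1)\<bar> = \<bar>expectation (\<lambda>\<omega>. exp (- R \<omega>) - exp (- 1))\<bar>"
      using intR by (simp add: prob_space)
    also have "\<dots> \<le> expectation (\<lambda>\<omega>. \<bar>exp (- R \<omega>) - exp (- 1)\<bar>)"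
      by (rule integral_abs_bound)
    also have "\<dots> \<le> expectation (\<lambda>\<omega>. \<epsilon> + indicator A \<omega>)"
    proof (rule integral_mono)
      show "integrable M (\<lambda>\<omega>. \<bar>exp (- R \<omega>) - exp (- 1)\<bar>)"
        using intR by (intro integrable_abs Bochner_Integration.integrable_diff) auto
      show "integrable M (\<lambda>\<omega>. \<epsilon> + indicator A \<omega>)"
        by (intro Bochner_Integration.integrable_add) (auto simp: less_top[symmetric])
    qed (rule bound)
    also have "\<dots> = \<epsilon> + prob A"
      by (simp add: prob_space emeasure_eq_measure)
    also have "\<dots> < \<delta>" using prob_A by (simp add: \<epsilon>_def)
    finally have "\<bar>expectation (\<lambda>\<omega>. exp (- R \<omega>)) - exp (- 1)\<bar> < \<delta>" .
    moreover have "expectation (\<lambda>\<omega>. exp (- R \<omega>)) = exp (- (LINT x:{0..t}|lebesgue. ln (1 + f x / lam t f)))"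
      using lap[of "1 / lam t f"] elim(2) by (simp add: R_def)
    ultimately show ?case by (simp only: dist_real_def)
  qed
qed

end

subsection \<open>Quotients of integrals\<close>

text \<open>Taking logarithms in the hypothesis gives \<open>d - ln (1 + d) \<le> ln u + 1\<close>,
  whose right-hand side tends to \<open>0\<close>. A quadratic lower bound for the left-hand side
  then squeezes \<open>d\<close> below \<open>sqrt (4 * (ln u + 1))\<close>.\<close>

lemma exp_gap_tendsto_zero:
  fixes d :: "'b \<Rightarrow> real"
  assumes bounds: "\<forall>\<^sub>F x in F. 0 \<le> d x \<and> d x \<le> 1"
    and le: "\<forall>\<^sub>F x in F. exp (- (1 - d x) - ln (1 + d x)) \<le> u x"
    and u: "(u \<longlongrightarrow> exp (- 1)) F"
  shows "(d \<longlongrightarrow> 0) F"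
proof -
  \<comment> \<open>With the constant \<open>1 / 4\<close> the derivative of the difference is
    \<open>x * (1 - x) / (2 * (1 + x))\<close>, which among \<open>x \<ge> 0\<close> is nonnegative
    exactly up to \<open>x = 1\<close>.\<close>
  have gap: "d\<^sup>2 / 4 \<le> d - ln (1 + d)" if "0 \<le> d" "d \<le> 1" for d :: real
  proof -
    define p where "p x = x - ln (1 + x) - x\<^sup>2 / 4" for x :: real
    have "p 0 \<le> p d"
    proof (rule DERIV_nonneg_imp_nondecreasing[OF that(1)])
      fix x assume x: "0 \<le> x" "x \<le> d"
      have "(p has_real_derivative (1 - 1 / (1 + x) - x / 2)) (at x)"
        unfolding p_def using x by (auto intro!: derivative_eq_intros)
      moreover have "1 - 1 / (1 + x) - x / 2 = x * (1 - x) / (2 * (1 + x))"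
        using x by (simp add: field_simps)
      ultimately show "\<exists>y. (p has_real_derivative y) (at x) \<and> 0 \<le> y"
        using x that by auto
    qed
    then show ?thesis by (simp add: p_def)
  qed
  have "((\<lambda>x. sqrt (4 * (ln (u x) + 1))) \<longlongrightarrow> sqrt (4 * (ln (exp (- 1)) + 1))) F"
    by (intro tendsto_intros u) simp
  then have lim: "((\<lambda>x. sqrt (4 * (ln (u x) + 1))) \<longlongrightarrow> 0) F" by simp
  show ?thesis
  proof (rule tendsto_sandwich[OF _ _ tendsto_const lim])
    show "\<forall>\<^sub>F x in F. 0 \<le> d x" using bounds by eventually_elim simp
    show "\<forall>\<^sub>F x in F. d x \<le> sqrt (4 * (ln (u x) + 1))"
      using bounds le
    proof eventually_elim
      case (elim x)
      have "ln (exp (- (1 - d x) - ln (1 + d x))) \<le> ln (u x)"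
        using elim(2) less_le_trans[OF exp_gt_zero elim(2)] by (subst ln_le_cancel_iff) auto
      then have "(d x)\<^sup>2 \<le> 4 * (ln (u x) + 1)"
        using gap[of "d x"] elim(1) by simp
      then show ?case by (rule real_le_rsqrt)
    qed
  qed
qed

lemma set_integrable_subinterval:
  assumes "locally_integrable f" "0 \<le> s" "A \<in> sets lebesgue" "A \<subseteq> {0..s}"
  shows "set_integrable lebesgue A f"
  using assms by (auto simp: locally_integrable_def intro: set_integrable_subset)

lemma lam_split:
  assumes "locally_integrable f" "0 \<le> s" "s \<le> t"
  shows "lam t f = lam s f + (LINT x:{s<..t}|lebesgue. f x)"
proof -
  have "{0..t} = {0..s} \<union> {s<..t}" "{0..s} \<inter> {s<..t} = {}" using assms by auto
  moreover have "set_integrable lebesgue {0..s} f" "set_integrable lebesgue {s<..t} f"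
    using assms by (auto intro!: set_integrable_subinterval[of f t])
  ultimately show ?thesis
    by (simp add: lam_def set_integral_Un)
qed

lemma lebesgue_integral_const_Ioc:
  fixes c :: real
  assumes "s \<le> t"
  shows "set_integrable lebesgue {s<..t} (\<lambda>_. c)"
    and "(LINT x:{s<..t}|lebesgue. c) = (t - s) * c"
  using assms by (simp_all add: set_integrable_def set_lebesgue_integral_def)

lemma Ioc_integral_mono:
  fixes f g :: "real \<Rightarrow> real"
  assumes "set_integrable lebesgue {s<..t} f" "set_integrable lebesgue {s<..t} g"
    and "\<And>x. s < x \<Longrightarrow> x \<le> t \<Longrightarrow> f x \<le> g x"
  shows "(LINT x:{s<..t}|lebesgue. f x) \<le> (LINT x:{s<..t}|lebesgue. g x)"
  using assms by (intro set_integral_mono) auto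

section \<open>Asymptotics of the quotients for a fixed integrand\<close>

context
  fixes f :: "real \<Rightarrow> real"
  assumes loc: "locally_integrable f"
    and f0: "\<And>x. 0 \<le> x \<Longrightarrow> 0 \<le> f x"
    and div: "filterlim (\<lambda>t. lam t f) at_top at_top"
begin

lemma eventually_lam_pos: "\<forall>\<^sub>F t in at_top. 0 < lam t f"
  using div by (simp add: filterlim_at_top_dense)

lemma Ioc_integrable: "0 \<le> s \<Longrightarrow> s \<le> t \<Longrightarrow> set_integrable lebesgue {s<..t} f"
  by (auto intro!: set_integrable_subinterval[OF loc, of t])

lemma Ioc_integral_nonneg: "0 \<le> s \<Longrightarrow> 0 \<le> (LINT x:{s<..t}|lebesgue. f x)"
  unfolding set_lebesgue_integral_def using f0
  by (intro Bochner_Integration.integral_nonneg) (auto simp: indicator_def)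

lemma lam_mono: "0 \<le> s \<Longrightarrow> s \<le> t \<Longrightarrow> lam s f \<le> lam t f"
  using lam_split[OF loc, of s t] Ioc_integral_nonneg[of s t] by simp

lemma lam_nonneg: "0 \<le> t \<Longrightarrow> 0 \<le> lam t f"
  unfolding lam_def set_lebesgue_integral_def using f0
  by (intro Bochner_Integration.integral_nonneg) (auto simp: indicator_def)

text \<open>On the last unit interval Jensen's inequality is obtained by bounding the logarithm by its
  tangent at the mean of the integrand; elsewhere the logarithm is bounded by its argument.\<close>

lemma integral_ln_le:
  assumes t: "1 \<le> t" and pos: "0 < lam t f"
  defines "d \<equiv> 1 - ell_quot f t"
  shows "0 \<le> d" "d \<le> 1"
    and "(LINT x:{0..t}|lebesgue. ln (1 + f x / lam t f)) \<le> (1 - d) + ln (1 + d)"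
proof -
  let ?L = "lam t f"
  define J where "J = (LINT x:{t - 1<..t}|lebesgue. f x)"
  have split: "?L = lam (t - 1) f + J"
    using t by (simp add: J_def lam_split[OF loc, of "t - 1" t])
  \<comment> \<open>So \<open>d\<close> is the share of the mass on the last unit interval. As that
    interval has length one, \<open>d\<close> is also the mean of \<open>f x / ?L\<close> over it,
    the point at which the tangent is taken.\<close>
  have d: "d = J / ?L"
    using pos split by (simp add: d_def ell_quot_def field_simps)
  have J0: "0 \<le> J" unfolding J_def using t by (intro Ioc_integral_nonneg) simp
  show d0: "0 \<le> d" using d J0 pos by simp
  show "d \<le> 1" using d split lam_nonneg[of "t - 1"] t pos by simp
  let ?g = "\<lambda>x. ln (1 + f x / ?L)"
  have fint: "set_integrable lebesgue {0..t} f"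
    using t by (intro set_integrable_subinterval[OF loc, of t]) auto
  have gint: "set_integrable lebesgue {0..t} ?g"
    unfolding set_integrable_def
  proof (rule Bochner_Integration.integrable_bound)
    show "integrable lebesgue (\<lambda>x. indicator {0..t} x *\<^sub>R f x / ?L)"
      using fint by (simp add: set_integrable_def)
    have [measurable]: "(\<lambda>x. indicator {0..t} x *\<^sub>R f x) \<in> borel_measurable lebesgue"
      using fint by (auto simp: set_integrable_def)
    \<comment> \<open>Measurability is known for the cut-off integrand only; the indicator may be
      moved inside the logarithm because \<open>ln 1 = 0\<close>.\<close>
    have "(\<lambda>x. ln (1 + (indicator {0..t} x *\<^sub>R f x) / ?L)) \<in> borel_measurable lebesgue"
      by measurable
    also have "(\<lambda>x. ln (1 + (indicator {0..t} x *\<^sub>R f x) / ?L)) = (\<lambda>x. indicator {0..t} x *\<^sub>R ?g x)"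
      by (auto simp: indicator_def)
    finally show "(\<lambda>x. indicator {0..t} x *\<^sub>R ?g x) \<in> borel_measurable lebesgue" .
    show "AE x in lebesgue. norm (indicator {0..t} x *\<^sub>R ?g x) \<le> norm (indicator {0..t} x *\<^sub>R f x / ?L)"
      using f0 pos by (intro AE_I2) (auto simp: indicator_def ln_add_one_self_le_self)
  qed
  have gint1: "set_integrable lebesgue {0..t - 1} ?g" and gint2: "set_integrable lebesgue {t - 1<..t} ?g"
    using t by (auto intro: set_integrable_subset[OF gint])
  have fint1: "set_integrable lebesgue {0..t - 1} (\<lambda>x. f x / ?L)"
    and fint2: "set_integrable lebesgue {t - 1<..t} (\<lambda>x. f x / ?L)"
    using t by (auto intro!: set_integrable_divide set_integrable_subset[OF fint])
  have "{0..t} = {0..t - 1} \<union> {t - 1<..t}" "{0..t - 1} \<inter> {t - 1<..t} = {}" using t by auto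
  then have "(LINT x:{0..t}|lebesgue. ?g x) =
      (LINT x:{0..t - 1}|lebesgue. ?g x) + (LINT x:{t - 1<..t}|lebesgue. ?g x)"
    using gint1 gint2 by (simp add: set_integral_Un)
  also have "(LINT x:{0..t - 1}|lebesgue. ?g x) \<le> (LINT x:{0..t - 1}|lebesgue. f x / ?L)"
    using gint1 fint1 f0 pos by (intro set_integral_mono) (auto simp: ln_add_one_self_le_self)
  also have "(LINT x:{0..t - 1}|lebesgue. f x / ?L) = 1 - d"
    using split pos by (simp add: d lam_def[symmetric] field_simps)
  \<comment> \<open>The new integrand is the tangent \<open>ln (1 + d) + (y - d) / (1 + d)\<close>
    at \<open>y = f x / ?L\<close>, expanded. Since \<open>y\<close> has mean \<open>d\<close>, the
    linear part integrates to zero and \<open>ln (1 + d)\<close> remains.\<close>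
  also have "(LINT x:{t - 1<..t}|lebesgue. ?g x) \<le>
      (LINT x:{t - 1<..t}|lebesgue. ln (1 + d) - d / (1 + d) + (1 / (1 + d)) * (f x / ?L))"
  proof (rule Ioc_integral_mono[OF gint2])
    show "set_integrable lebesgue {t - 1<..t} (\<lambda>x. ln (1 + d) - d / (1 + d) + (1 / (1 + d)) * (f x / ?L))"
      using fint2 by (intro set_integral_add set_integrable_mult_right lebesgue_integral_const_Ioc) auto
    fix x assume x: "t - 1 < x" "x \<le> t"
    define y where "y = f x / ?L"
    have y: "0 \<le> y" using x t f0 pos by (simp add: y_def)
    have "ln (1 + y) - ln (1 + d) = ln ((1 + y) / (1 + d))"
      using y d0 by (simp add: ln_div)
    also have "\<dots> \<le> (1 + y) / (1 + d) - 1"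
      using y d0 by (intro ln_le_minus_one) simp
    also have "\<dots> = - d / (1 + d) + (1 / (1 + d)) * y"
      using d0 by (simp add: divide_simps)
    finally show "?g x \<le> ln (1 + d) - d / (1 + d) + (1 / (1 + d)) * (f x / ?L)"
      by (simp add: y_def)
  qed
  also have "\<dots> = (ln (1 + d) - d / (1 + d)) + (1 / (1 + d)) * (J / ?L)"
    using fint2 by (subst set_integral_add)
      (auto simp: lebesgue_integral_const_Ioc J_def)
  also have "\<dots> = ln (1 + d)" by (simp add: d)
  finally show "(LINT x:{0..t}|lebesgue. ?g x) \<le> (1 - d) + ln (1 + d)" by simp
qed

text \<open>The square integral up to a fixed \<open>T\<close> is a constant, negligible against
  \<open>(lam t f)\<^sup>2\<close>. Beyond \<open>T\<close> one factor \<open>f x\<close> is bounded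
  by \<open>e / 2 * lam t f\<close>, through monotonicity of \<open>lam\<close>, and the other
  factor integrates to at most \<open>lam t f\<close>.\<close>

lemma v_quot_tendsto_zero:
  assumes sq: "locally_integrable (\<lambda>x. (f x)\<^sup>2)" and b: "(b_quot f \<longlongrightarrow> 0) at_top"
  shows "(v_quot f \<longlongrightarrow> 0) at_top"
proof (rule tendstoI)
  fix e :: real assume e: "0 < e"
  have "\<forall>\<^sub>F t in at_top. b_quot f t < e / 2"
    using b e by (intro order_tendstoD(2)[OF b]) simp
  then have "\<forall>\<^sub>F t in at_top. f t \<le> e / 2 * lam t f"
    using eventually_lam_pos by eventually_elim (simp add: b_quot_def field_simps)
  then obtain T0 where T0: "\<And>t. T0 \<le> t \<Longrightarrow> f t \<le> e / 2 * lam t f"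
    by (auto simp: eventually_at_top_linorder)
  \<comment> \<open>The maximum with \<open>0\<close> keeps \<open>T\<close> in the half line, where
    \<open>f\<close> is controlled.\<close>
  define T where "T = max 0 T0"
  define C where "C = lam T (\<lambda>x. (f x)\<^sup>2)"
  have "filterlim (\<lambda>t. (lam t f)\<^sup>2) at_top at_top"
    using div by (intro filterlim_pow_at_top) auto
  then have "((\<lambda>t. C / (lam t f)\<^sup>2) \<longlongrightarrow> 0) at_top"
    by (rule real_tendsto_divide_at_top[OF tendsto_const])
  then have "\<forall>\<^sub>F t in at_top. C / (lam t f)\<^sup>2 < e / 2"
    using e by (intro order_tendstoD(2)) auto
  then show "\<forall>\<^sub>F t in at_top. dist (v_quot f t) 0 < e"
    using eventually_lam_pos eventually_ge_at_top[of T]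
  proof eventually_elim
    case (elim t)
    have T: "0 \<le> T" "T0 \<le> T" by (auto simp: T_def)
    have "(LINT x:{T<..t}|lebesgue. (f x)\<^sup>2) \<le> (LINT x:{T<..t}|lebesgue. (e / 2 * lam t f) * f x)"
    proof (rule Ioc_integral_mono)
      show "set_integrable lebesgue {T<..t} (\<lambda>x. (f x)\<^sup>2)"
        using T elim by (auto intro!: set_integrable_subinterval[OF sq, of t])
      show "set_integrable lebesgue {T<..t} (\<lambda>x. (e / 2 * lam t f) * f x)"
        using T elim by (intro set_integrable_mult_right Ioc_integrable) auto
      fix x assume x: "T < x" "x \<le> t"
      have "f x \<le> e / 2 * lam x f" using T0[of x] x T by simp
      also have "\<dots> \<le> e / 2 * lam t f" using lam_mono[of x t] x T e by simp
      finally show "(f x)\<^sup>2 \<le> (e / 2 * lam t f) * f x"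
        using f0[of x] x T unfolding power2_eq_square by (intro mult_right_mono) auto
    qed
    also have "\<dots> = (e / 2 * lam t f) * (lam t f - lam T f)"
      using lam_split[OF loc, of T t] T elim by simp
    also have "\<dots> \<le> (e / 2 * lam t f) * lam t f"
      using lam_nonneg[of T] T e elim by (intro mult_left_mono) auto
    finally have le: "lam t (\<lambda>x. (f x)\<^sup>2) \<le> C + e / 2 * (lam t f)\<^sup>2"
      using lam_split[OF sq, of T t] T elim by (simp add: C_def power2_eq_square)
    have "v_quot f t \<le> C / (lam t f)\<^sup>2 + e / 2"
      using divide_right_mono[OF le, of "(lam t f)\<^sup>2"] elim by (simp add: v_quot_def add_divide_distrib)
    moreover have "0 \<le> v_quot f t"
      unfolding v_quot_def lam_def set_lebesgue_integral_def
      by (intro divide_nonneg_nonneg Bochner_Integration.integral_nonneg) auto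
    ultimately have "\<bar>v_quot f t\<bar> < e" using elim(1) by linarith
    then show ?case by (simp add: dist_real_def)
  qed
qed

section \<open>Mass of the last unit interval and monotonic integrands\<close>

lemma ell_quot_eq:
  assumes "1 \<le> t" "0 < lam t f"
  shows "ell_quot f t = 1 - (LINT x:{t - 1<..t}|lebesgue. f x) / lam t f"
  using lam_split[OF loc, of "t - 1" t] assms by (simp add: ell_quot_def field_simps)

text \<open>The defect \<open>1 - ell_quot f t\<close> is the share of the last unit interval and
  hence nonnegative, so a vanishing upper bound suffices.\<close>

lemma ell_quot_tendsto_oneI:
  assumes u: "(u \<longlongrightarrow> 0) at_top"
    and le: "\<forall>\<^sub>F t in at_top. (LINT x:{t - 1<..t}|lebesgue. f x) / lam t f \<le> u t"
  shows "(ell_quot f \<longlongrightarrow> 1) at_top"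
proof -
  have "((\<lambda>t. (LINT x:{t - 1<..t}|lebesgue. f x) / lam t f) \<longlongrightarrow> 0) at_top"
  proof (rule tendsto_sandwich[OF _ le tendsto_const u])
    show "\<forall>\<^sub>F t in at_top. 0 \<le> (LINT x:{t - 1<..t}|lebesgue. f x) / lam t f"
      using eventually_lam_pos eventually_ge_at_top[of 1]
      by eventually_elim (simp add: Ioc_integral_nonneg)
  qed
  from tendsto_diff[OF tendsto_const[of 1] this]
  have "((\<lambda>t. 1 - (LINT x:{t - 1<..t}|lebesgue. f x) / lam t f) \<longlongrightarrow> 1) at_top" by simp
  moreover have "\<forall>\<^sub>F t in at_top. 1 - (LINT x:{t - 1<..t}|lebesgue. f x) / lam t f = ell_quot f t"
    using eventually_lam_pos eventually_ge_at_top[of 1] by eventually_elim (simp add: ell_quot_eq)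
  ultimately show ?thesis by (rule Lim_transform_eventually)
qed

lemma unit_integral_le:
  assumes "0 \<le> s" "\<And>x. s < x \<Longrightarrow> x \<le> s + 1 \<Longrightarrow> f x \<le> c"
  shows "(LINT x:{s<..s + 1}|lebesgue. f x) \<le> c"
  using Ioc_integral_mono[OF Ioc_integrable[of s "s + 1"] lebesgue_integral_const_Ioc(1)[of s "s + 1" c]] assms
  by (simp add: lebesgue_integral_const_Ioc)

lemma unit_integral_ge:
  assumes "0 \<le> s" "\<And>x. s < x \<Longrightarrow> x \<le> s + 1 \<Longrightarrow> c \<le> f x"
  shows "c \<le> (LINT x:{s<..s + 1}|lebesgue. f x)"
  using Ioc_integral_mono[OF lebesgue_integral_const_Ioc(1)[of s "s + 1" c] Ioc_integrable[of s "s + 1"]] assms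
  by (simp add: lebesgue_integral_const_Ioc)

text \<open>For increasing \<open>f\<close> the value \<open>f t\<close> dominates the integral over
  the preceding unit interval, which gives one direction, and is dominated by the integral over the
  following one, which gives the other.\<close>

lemma mono_ell_iff_b:
  assumes mono: "mono_on {0..} f"
  shows "(ell_quot f \<longlongrightarrow> 1) at_top \<longleftrightarrow> (b_quot f \<longlongrightarrow> 0) at_top"
proof
  assume "(b_quot f \<longlongrightarrow> 0) at_top"
  then show "(ell_quot f \<longlongrightarrow> 1) at_top"
  proof (rule ell_quot_tendsto_oneI)
    show "\<forall>\<^sub>F t in at_top. (LINT x:{t - 1<..t}|lebesgue. f x) / lam t f \<le> b_quot f t"
      using eventually_lam_pos eventually_ge_at_top[of 1]
    proof eventually_elim
      case (elim t)
      then show ?case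
        using unit_integral_le[of "t - 1" "f t"] mono_onD[OF mono]
        by (auto simp: b_quot_def intro!: divide_right_mono)
    qed
  qed
next
  assume ell: "(ell_quot f \<longlongrightarrow> 1) at_top"
  \<comment> \<open>The shift brings in the following unit interval:
    \<open>1 / ell_quot f (t + 1) - 1\<close> is its mass relative to
    \<open>lam t f\<close>.\<close>
  have "filterlim (\<lambda>t::real. t + 1) at_top at_top" by real_asymp
  from filterlim_compose[OF ell this]
  have "((\<lambda>t. 1 / ell_quot f (t + 1) - 1) \<longlongrightarrow> 1 / 1 - 1) at_top"
    by (intro tendsto_intros) auto
  then have lim: "((\<lambda>t. 1 / ell_quot f (t + 1) - 1) \<longlongrightarrow> 0) at_top" by simp
  show "(b_quot f \<longlongrightarrow> 0) at_top"
  proof (rule tendsto_sandwich[OF _ _ tendsto_const lim])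
    show "\<forall>\<^sub>F t in at_top. 0 \<le> b_quot f t"
      using eventually_lam_pos eventually_ge_at_top[of 0]
      by eventually_elim (simp add: b_quot_def f0)
    show "\<forall>\<^sub>F t in at_top. b_quot f t \<le> 1 / ell_quot f (t + 1) - 1"
      using eventually_lam_pos eventually_ge_at_top[of 0]
    proof eventually_elim
      case (elim t)
      have "f t \<le> (LINT x:{t<..t + 1}|lebesgue. f x)"
        using elim mono_onD[OF mono] by (intro unit_integral_ge) auto
      also have "\<dots> = lam (t + 1) f - lam t f"
        using lam_split[OF loc, of t "t + 1"] elim by simp
      finally show ?case
        using elim by (simp add: b_quot_def ell_quot_def field_simps)
    qed
  qed
qed

text \<open>Both limits hold outright, which makes the equivalence trivial for decreasing
  \<open>f\<close>: such an \<open>f\<close> is bounded by \<open>f 0\<close> while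
  \<open>lam t f\<close> diverges.\<close>

lemma antimono_ell_b:
  assumes mono: "antimono_on {0..} f"
  shows "(ell_quot f \<longlongrightarrow> 1) at_top" "(b_quot f \<longlongrightarrow> 0) at_top"
proof -
  have le: "f x \<le> f 0" if "0 \<le> x" for x
    using monotone_onD[OF mono, of 0 x] that by simp
  have lim: "((\<lambda>t. f 0 / lam t f) \<longlongrightarrow> 0) at_top"
    using div by (rule real_tendsto_divide_at_top[OF tendsto_const])
  show "(ell_quot f \<longlongrightarrow> 1) at_top"
  proof (rule ell_quot_tendsto_oneI[OF lim])
    show "\<forall>\<^sub>F t in at_top. (LINT x:{t - 1<..t}|lebesgue. f x) / lam t f \<le> f 0 / lam t f"
      using eventually_lam_pos eventually_ge_at_top[of 1]
    proof eventually_elim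
      case (elim t)
      then show ?case
        using unit_integral_le[of "t - 1" "f 0"] le by (auto intro!: divide_right_mono)
    qed
  qed
  show "(b_quot f \<longlongrightarrow> 0) at_top"
  proof (rule tendsto_sandwich[OF _ _ tendsto_const lim])
    show "\<forall>\<^sub>F t in at_top. 0 \<le> b_quot f t" "\<forall>\<^sub>F t in at_top. b_quot f t \<le> f 0 / lam t f"
      using eventually_lam_pos eventually_ge_at_top[of 0]
      by (eventually_elim, simp add: b_quot_def f0 le divide_right_mono)+
  qed
qed

text \<open>With \<open>d = 1 - ell_quot f t\<close>, the Jensen bound of
  \<open>integral_ln_le\<close> is, after exponentiation, the inequality that
  \<open>exp_gap_tendsto_zero\<close> takes as input.\<close>

lemma ell_quot_tendsto_one_of_laplace:
  assumes "((\<lambda>t. exp (- (LINT x:{0..t}|lebesgue. ln (1 + f x / lam t f)))) \<longlongrightarrow> exp (- 1)) at_top"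
  shows "(ell_quot f \<longlongrightarrow> 1) at_top"
proof -
  have ev: "\<forall>\<^sub>F t in at_top. 1 \<le> t \<and> 0 < lam t f"
    using eventually_lam_pos eventually_ge_at_top[of 1] by eventually_elim simp
  have "((\<lambda>t. 1 - ell_quot f t) \<longlongrightarrow> 0) at_top"
  proof (rule exp_gap_tendsto_zero[OF _ _ assms])
    show "\<forall>\<^sub>F t in at_top. 0 \<le> 1 - ell_quot f t \<and> 1 - ell_quot f t \<le> 1"
      using ev by eventually_elim (use integral_ln_le in blast)
    show "\<forall>\<^sub>F t in at_top. exp (- (1 - (1 - ell_quot f t)) - ln (1 + (1 - ell_quot f t))) \<le>
        exp (- (LINT x:{0..t}|lebesgue. ln (1 + f x / lam t f)))"
      using ev
    proof eventually_elim
      case (elim t)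
      then show ?case using integral_ln_le(3)[of t] by simp
    qed
  qed
  from tendsto_diff[OF tendsto_const[of 1] this] show ?thesis by simp
qed

end

theorem theorem1p1:
  fixes M :: "'a measure" and S :: "real \<Rightarrow> 'a \<Rightarrow> real" and f :: "real \<Rightarrow> real"
  assumes gamma: "gamma_process M S"
    and nonneg: "\<And>x. 0 \<le> x \<Longrightarrow> 0 \<le> f x"
    and loc_int: "locally_integrable f"
    and diverges: "filterlim (\<lambda>t. lam t f) at_top at_top"
  shows "(orderly_divergence M S f \<longrightarrow> (ell_quot f \<longlongrightarrow> 1) at_top)
    \<and> (locally_integrable (\<lambda>x. (f x)\<^sup>2) \<and> filterlim f at_top at_top \<longrightarrow>
         (b_quot f \<longlongrightarrow> 0) at_top \<longrightarrow> (v_quot f \<longlongrightarrow> 0) at_top)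
    \<and> (mono_on {0..} f \<or> antimono_on {0..} f \<longrightarrow>
         ((ell_quot f \<longlongrightarrow> 1) at_top \<longleftrightarrow> (b_quot f \<longlongrightarrow> 0) at_top))"
proof (intro conjI impI)
  interpret gamma_process M S by (rule gamma)
  note ctx = loc_int nonneg diverges
  show "(ell_quot f \<longlongrightarrow> 1) at_top" if "orderly_divergence M S f"
    using ctx orderly_divergence_imp_laplace_tendsto[OF that ctx]
    by (rule ell_quot_tendsto_one_of_laplace)
  show "(v_quot f \<longlongrightarrow> 0) at_top"
    if "locally_integrable (\<lambda>x. (f x)\<^sup>2) \<and> filterlim f at_top at_top" "(b_quot f \<longlongrightarrow> 0) at_top"
    using ctx conjunct1[OF that(1)] that(2) by (rule v_quot_tendsto_zero)
  show "(ell_quot f \<longlongrightarrow> 1) at_top \<longleftrightarrow> (b_quot f \<longlongrightarrow> 0) at_top"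
    if "mono_on {0..} f \<or> antimono_on {0..} f"
    using that mono_ell_iff_b[OF ctx] antimono_ell_b[OF ctx] by blast
qed

end
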